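(* Let $f$ be a Boolean function with at least $2$ essential variables. Then the arity gap of $f$ is $2$ if and only if the Zhegalkin polynomial of $f$ is of one of the following special forms (where distinct index symbols denote distinct variable indices): \begin{itemize} \item $x_{i_1} + x_{i_2} + \dots + x_{i_n} + c$, \item $x_i x_j + x_i + c$, \item $x_i x_j + x_i x_k + x_j x_k + c$, \item $x_i x_j + x_i x_k + x_j x_k + x_i + x_j + c$, \end{itemize} where $c \in \{0,1\}$. Otherwise the arity gap of $f$ is $1$.
   Context: A Boolean function is a mapping $f : \{0,1\}^N \to \{0,1\}$ for some positive integer $N$, called the arity of $f$. The variable $x_i$ is essential in $f$ if there are $a_1, \ldots, a_N, b \in \{0,1\}$ such that $f(a_1, \ldots, a_i, \ldots, a_N) \neq f(a_1, \ldots, a_{i-1}, b, a_{i+1}, \ldots, a_N)$. The number of essential variables of $f$ is denoted $\mathrm{ess}\, f$. Every Boolean function is represented by a unique multilinear polynomial over the two-element field; this is called the Zhegalkin polynomial of $f$. An $m$-ary function $g$ is obtained from an $n$-ary function $f$ by simple variable substitution if there is a mapping $\sigma : \{1,\ldots,n\} \to \{1,\ldots,m\}$ with $g(x_1,\ldots,x_m) = f(x_{\sigma(1)},\ldots,x_{\sigma(n)})$. Write $g \leq f$ if $g$ is obtained from $f$ by simple variable substitution, and $g < f$ if $g \leq f$ but $f \not\leq g$. For indices $i \neq j$ such that $x_i$ and $x_j$ are essential in $f$, the variable identification minor $f_{i \gets j}$ is the function $f_{i \gets j}(x_1, \ldots, x_N) = f(x_1, \ldots, x_{i-1}, x_j,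 x_{i+1}, \ldots, x_N)$. The maximum essential arity of a variable identification minor of $f$ is denoted $\mathrm{ess}^{<} f = \max_{g < f} \mathrm{ess}\, g$, and the arity gap of $f$ is $\mathrm{gap}\, f = \mathrm{ess}\, f - \mathrm{ess}^{<} f$. *)

theory Defs
  imports Main "HOL-Library.FuncSet" "HOL-Library.Z2" "HOL-Library.Poly_Mapping"
begin

text \<open>
  A Boolean function of arity \<open>n\<close> is given by \<open>n\<close> together with a function
  \<open>f :: (nat \<Rightarrow> bit) \<Rightarrow> bit\<close>, of which only the values on \<open>cube n\<close> matter. The variables are
  indexed by \<open>{1..n}\<close>, and \<open>bit\<close> is the two-element field.
\<close>

definition cube :: "nat \<Rightarrow> (nat \<Rightarrow> bit) set" where
  "cube n = {1..n} \<rightarrow>\<^sub>E UNIV"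

definition essential :: "nat \<Rightarrow> ((nat \<Rightarrow> bit) \<Rightarrow> bit) \<Rightarrow> nat \<Rightarrow> bool" where
  "essential n f i \<longleftrightarrow> i \<in> {1..n} \<and> (\<exists>a\<in>cube n. \<exists>b. f a \<noteq> f (a(i := b)))"

definition ess :: "nat \<Rightarrow> ((nat \<Rightarrow> bit) \<Rightarrow> bit) \<Rightarrow> nat" where
  "ess n f = card {i. essential n f i}"

text \<open>\<open>subst_le m g n f\<close> is the relation \<open>g \<le> f\<close>, where \<open>g\<close> is \<open>m\<close>-ary and \<open>f\<close> is \<open>n\<close>-ary.\<close>

definition subst_le :: "nat \<Rightarrow> ((nat \<Rightarrow> bit) \<Rightarrow> bit) \<Rightarrow> nat \<Rightarrow> ((nat \<Rightarrow> bit) \<Rightarrow> bit) \<Rightarrow> bool" where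
  "subst_le m g n f \<longleftrightarrow>
     (\<exists>\<sigma> \<in> {1..n} \<rightarrow> {1..m}. \<forall>x\<in>cube m. g x = f (\<lambda>k\<in>{1..n}. x (\<sigma> k)))"

definition subst_less :: "nat \<Rightarrow> ((nat \<Rightarrow> bit) \<Rightarrow> bit) \<Rightarrow> nat \<Rightarrow> ((nat \<Rightarrow> bit) \<Rightarrow> bit) \<Rightarrow> bool" where
  "subst_less m g n f \<longleftrightarrow> subst_le m g n f \<and> \<not> subst_le n f m g"

text \<open>
  The set below is bounded by \<open>ess n f\<close>, hence finite. It is nonempty if \<open>f\<close> has at least two
  essential variables; otherwise it may be empty and the value is unspecified.
\<close>

definition ess_less :: "nat \<Rightarrow> ((nat \<Rightarrow> bit) \<Rightarrow> bit) \<Rightarrow> nat" where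
  "ess_less n f = Max {ess m g | m g. 0 < m \<and> subst_less m g n f}"

definition gap :: "nat \<Rightarrow> ((nat \<Rightarrow> bit) \<Rightarrow> bit) \<Rightarrow> int" where
  "gap n f = int (ess n f) - int (ess_less n f)"

text \<open>
  Polynomials over the two-element field in variables indexed by natural numbers: a monomial is
  its finitely supported exponent vector, a polynomial a finitely supported coefficient function
  on monomials. The ring operations are those of \<open>HOL-Library.Poly_Mapping\<close>.
\<close>

type_synonym bit_mpoly = "(nat \<Rightarrow>\<^sub>0 nat) \<Rightarrow>\<^sub>0 bit"

definition X :: "nat \<Rightarrow> bit_mpoly" where
  "X i = Poly_Mapping.single (Poly_Mapping.single i 1) 1"

definition C :: "bit \<Rightarrow> bit_mpoly" where
  "C c = Poly_Mapping.single 0 c"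

definition eval_mpoly :: "bit_mpoly \<Rightarrow> (nat \<Rightarrow> bit) \<Rightarrow> bit" where
  "eval_mpoly p a =
     (\<Sum>m\<in>Poly_Mapping.keys p.
        Poly_Mapping.lookup p m * (\<Prod>i\<in>Poly_Mapping.keys m. a i ^ Poly_Mapping.lookup m i))"

definition multilinear :: "nat \<Rightarrow> bit_mpoly \<Rightarrow> bool" where
  "multilinear n p \<longleftrightarrow>
     (\<forall>m\<in>Poly_Mapping.keys p.
        Poly_Mapping.keys m \<subseteq> {1..n} \<and> (\<forall>i. Poly_Mapping.lookup m i \<le> 1))"

definition zhegalkin :: "nat \<Rightarrow> ((nat \<Rightarrow> bit) \<Rightarrow> bit) \<Rightarrow> bit_mpoly" where
  "zhegalkin n f = (THE p. multilinear n p \<and> (\<forall>a\<in>cube n. eval_mpoly p a = f a))"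

definition special_form :: "nat \<Rightarrow> bit_mpoly \<Rightarrow> bool" where
  "special_form n p \<longleftrightarrow> (\<exists>c.
     (\<exists>I. I \<noteq> {} \<and> I \<subseteq> {1..n} \<and> p = (\<Sum>i\<in>I. X i) + C c) \<or>
     (\<exists>i\<in>{1..n}. \<exists>j\<in>{1..n}. i \<noteq> j \<and> p = X i * X j + X i + C c) \<or>
     (\<exists>i\<in>{1..n}. \<exists>j\<in>{1..n}. \<exists>k\<in>{1..n}. i \<noteq> j \<and> i \<noteq> k \<and> j \<noteq> k \<and>
        p = X i * X j + X i * X k + X j * X k + C c) \<or>
     (\<exists>i\<in>{1..n}. \<exists>j\<in>{1..n}. \<exists>k\<in>{1..n}. i \<noteq> j \<and> i \<noteq> k \<and> j \<noteq> k \<and>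
        p = X i * X j + X i * X k + X j * X k + X i + X j + C c))"

end

theory Submission
  imports Defs
begin

text \<open>
  The arity gap compares \<open>f\<close> with its strict minors. A strict minor must merge two essential variables
  of \<open>f\<close>, for otherwise the substitution could be undone; so only the minors obtained by identifying two
  essential variables matter (\<open>ess_strict_minor_le_identify\<close>, \<open>ess_less_properties\<close>). The gap is \<open>1\<close> iff
  some identification loses only the variable that is merged away. It remains to determine the functions
  for which every identification is lossy, that is, loses more.

  Identifying \<open>i\<close> with \<open>j\<close> can lose the merged variable (\<open>f\<close> does not change when two equal bits at \<open>i\<close>
  and \<open>j\<close> are flipped together), or absorb a third variable \<open>k\<close> (\<open>f\<close> does not depend on \<open>k\<close> where the bits
  at \<open>i\<close> and \<open>j\<close> agree).

  If nothing is ever absorbed, all pairs cancel. With at least three variables, flips of two equal bits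
  compose to flips of any two bits, so \<open>f\<close> is a parity up to a constant (\<open>cancels_imp_double_flip\<close>,
  \<open>parity_of_double_flip\<close>); with two variables one gets the parity or \<open>x\<^sub>i x\<^sub>j + x\<^sub>i + c\<close>
  (\<open>two_variables_cancelling\<close>).

  If the pair \<open>i, j\<close> absorbs something, the key is to choose the absorbed variable \<open>k\<close> well. Suppose that
  identifying \<open>k\<close> with \<open>i\<close> absorbs a further variable \<open>l\<close> other than \<open>j\<close>. Then \<open>i, j\<close> absorbs \<open>l\<close>
  too, and lossiness of the pair \<open>j, k\<close> forces yet another absorbed variable (\<open>next_absorber\<close>); a count
  shows that \<open>l\<close> has strictly fewer such successors than \<open>k\<close> (\<open>card_successors_decreases\<close>). Hence a \<open>k\<close>
  with the fewest successors has none. For it, the pairs \<open>i, k\<close> and \<open>j, k\<close> can lose only variables among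
  \<open>i\<close>, \<open>j\<close>, \<open>k\<close>, which forces \<open>f\<close> to see these three bits only through their majority, with the bit at
  \<open>k\<close> possibly negated (\<open>maj_reduction\<close>). A fourth essential variable \<open>l\<close> is then impossible, because the
  pair \<open>k, l\<close> would not be lossy (\<open>no_fourth_variable\<close>). Thus \<open>f\<close> is a majority up to constants, which
  covers the last two special forms.

  Conversely, each special function loses at least two variables in every identification and exactly two
  in some (\<open>special_fun_identifications\<close>), so its gap is \<open>2\<close>. Existence and uniqueness of the Zhegalkin
  polynomial (\<open>zhegalkin_eq_iff\<close>) translate between functions and polynomials.
\<close>

section \<open>Flips and essential variables\<close>

text \<open>
  The default simplification rules of type \<open>bit\<close> turn its field operations into bitwise connectives;
  the calculations below take place in the field.
\<close>

declare add_bit_eq_xor [simp del] mult_bit_eq_and [simp del] power_bit_unfold [simp del]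

lemma bit_add_self [simp]: "a + a = (0 :: bit)"
  by (cases a) simp_all

lemma bit_add_self_left [simp]: "a + (a + b) = (b :: bit)"
  by (simp flip: add.assoc)

lemma bit_neq_iff: "a \<noteq> b \<longleftrightarrow> a = b + (1 :: bit)"
  by (cases a; cases b) simp_all

text \<open>
  The combinatorial part works with functions \<open>F\<close> on all assignments \<open>nat \<Rightarrow> bit\<close>, so that flipping
  a variable never leaves the domain; finiteness enters only through \<open>depends_only_on\<close>.
\<close>

definition flip :: "nat \<Rightarrow> (nat \<Rightarrow> bit) \<Rightarrow> nat \<Rightarrow> bit" where
  "flip k x = x(k := x k + 1)"

lemma flip_same [simp]: "flip k x k = x k + 1"
  and flip_other [simp]: "i \<noteq> k \<Longrightarrow> flip k x i = x i"
  by (simp_all add: flip_def)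

lemma flip_flip [simp]: "flip k (flip k x) = x"
  by (auto simp: flip_def add.assoc)

lemma flip_commute: "flip k (flip l x) = flip l (flip k x)"
  by (auto simp: flip_def fun_eq_iff)

definition ess_vars :: "((nat \<Rightarrow> bit) \<Rightarrow> bit) \<Rightarrow> nat set" where
  "ess_vars F = {i. \<exists>x. F (flip i x) \<noteq> F x}"

definition depends_only_on :: "((nat \<Rightarrow> bit) \<Rightarrow> bit) \<Rightarrow> nat set \<Rightarrow> bool" where
  "depends_only_on F V \<longleftrightarrow> (\<forall>x y. (\<forall>i\<in>V. x i = y i) \<longrightarrow> F x = F y)"

lemma depends_only_onD: "depends_only_on F V \<Longrightarrow> (\<And>i. i \<in> V \<Longrightarrow> x i = y i) \<Longrightarrow> F x = F y"
  unfolding depends_only_on_def by blast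

lemma depends_only_on_empty: "depends_only_on F {} \<Longrightarrow> F x = F y"
  by (rule depends_only_onD) auto

lemma ess_vars_subset: "depends_only_on F V \<Longrightarrow> ess_vars F \<subseteq> V"
  unfolding ess_vars_def by (auto, metis depends_only_onD flip_other)

lemma inessential_upd:
  assumes "i \<notin> ess_vars F"
  shows "F (x(i := b)) = F x"
proof (cases "b = x i")
  case False
  then have "x(i := b) = flip i x"
    by (simp add: flip_def bit_neq_iff)
  with assms show ?thesis by (auto simp: ess_vars_def)
qed simp

text \<open>
  Two assignments that agree on the essential variables agree on \<open>V\<close> after finitely many changes of
  inessential variables. This fails without finiteness: a tail property of an infinite bit sequence
  has no essential variable at all.
\<close>

lemma depends_only_on_ess_vars:
  assumes "finite V" "depends_only_on F V"
  shows "depends_only_on F (ess_vars F)"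
proof -
  have *: "depends_only_on F (ess_vars F)" if "finite W" "depends_only_on F (ess_vars F \<union> W)" for W
    using that
  proof (induction W)
    case (insert w W)
    have "depends_only_on F (ess_vars F \<union> W)"
    proof (cases "w \<in> ess_vars F")
      case True
      with insert.prems show ?thesis by (simp add: insert_absorb)
    next
      case False
      show ?thesis unfolding depends_only_on_def
      proof (intro allI impI)
        fix x y :: "nat \<Rightarrow> bit"
        assume "\<forall>i\<in>ess_vars F \<union> W. x i = y i"
        then have "F (x(w := y w)) = F y"
          by (intro depends_only_onD[OF insert.prems]) auto
        with inessential_upd[OF False] show "F x = F y" by simp
      qed
    qed
    then show ?case by (rule insert.IH)
  qed simp
  have "depends_only_on F (ess_vars F \<union> V)"
    using assms(2) by (auto simp: depends_only_on_def)
  from *[OF assms(1) this] show ?thesis .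
qed

section \<open>How an identification loses variables\<close>

text \<open>
  When \<open>x i\<close> is identified with \<open>x j\<close>, a third variable \<open>k\<close> becomes inessential iff
  \<open>absorbs F i j k\<close>, and the merged variable becomes inessential iff \<open>cancels F i j\<close>. Hence a pair
  of essential variables is \<open>lossy\<close> iff its identification destroys more than the one variable that is merged away.
\<close>

definition absorbs :: "((nat \<Rightarrow> bit) \<Rightarrow> bit) \<Rightarrow> nat \<Rightarrow> nat \<Rightarrow> nat \<Rightarrow> bool" where
  "absorbs F i j k \<longleftrightarrow> i \<noteq> j \<and> k \<noteq> i \<and> k \<noteq> j \<and> (\<forall>x. x i = x j \<longrightarrow> F (flip k x) = F x)"

definition cancels :: "((nat \<Rightarrow> bit) \<Rightarrow> bit) \<Rightarrow> nat \<Rightarrow> nat \<Rightarrow> bool" where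
  "cancels F i j \<longleftrightarrow> (\<forall>x. x i = x j \<longrightarrow> F (flip i (flip j x)) = F x)"

definition lossy :: "((nat \<Rightarrow> bit) \<Rightarrow> bit) \<Rightarrow> nat \<Rightarrow> nat \<Rightarrow> bool" where
  "lossy F i j \<longleftrightarrow> cancels F i j \<or> (\<exists>k\<in>ess_vars F. absorbs F i j k)"

lemma absorbsD: "absorbs F i j k \<Longrightarrow> x i = x j \<Longrightarrow> F (flip k x) = F x"
  and absorbs_distinct: "absorbs F i j k \<Longrightarrow> i \<noteq> j \<and> k \<noteq> i \<and> k \<noteq> j"
  unfolding absorbs_def by blast+

lemma absorbs_commute: "absorbs F i j k \<longleftrightarrow> absorbs F j i k"
  unfolding absorbs_def by metis

lemma cancels_commute: "cancels F i j \<longleftrightarrow> cancels F j i"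
  unfolding cancels_def by (metis flip_commute)

text \<open>
  On an assignment with \<open>x i = x j\<close>, the variable \<open>k\<close> can be flipped freely, in particular so that it
  equals \<open>x a\<close>; there \<open>l\<close> is irrelevant. So \<open>l\<close> is absorbed by the pair \<open>i, j\<close> as well.
\<close>

lemma absorbs_trans:
  assumes k: "absorbs F i j k" and l: "absorbs F a k l" and "l \<noteq> i" "l \<noteq> j"
  shows "absorbs F i j l"
  unfolding absorbs_def
proof (intro conjI allI impI)
  fix x :: "nat \<Rightarrow> bit"
  assume eq: "x i = x j"
  show "F (flip l x) = F x"
  proof (cases "x a = x k")
    case True
    then show ?thesis by (rule absorbsD[OF l])
  next
    case False
    with absorbs_distinct[OF l] have "flip k x a = flip k x k"
      by (simp add: bit_neq_iff)
    then have "F (flip l (flip k x)) = F (flip k x)" by (rule absorbsD[OF l])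
    moreover have "F (flip k x) = F x" using absorbsD[OF k eq] .
    moreover have "F (flip k (flip l x)) = F (flip l x)"
      using absorbs_distinct[OF k] assms(3,4) eq by (intro absorbsD[OF k]) simp
    ultimately show ?thesis by (simp add: flip_commute)
  qed
qed (use assms absorbs_distinct[OF k] in auto)

text \<open>
  Among three bits, two are always equal.
\<close>

lemma no_absorbing_triangle:
  assumes "absorbs F i j k" "absorbs F j l k" "absorbs F i l k"
  shows "k \<notin> ess_vars F"
proof -
  have "F (flip k x) = F x" for x
    using assms[THEN absorbsD, of x] by (cases "x i"; cases "x j"; cases "x l") auto
  then show ?thesis by (simp add: ess_vars_def)
qed

text \<open>
  The derivative of \<open>F\<close> with respect to \<open>l\<close> is supported where \<open>x j = x k\<close> differs from \<open>x i\<close>. A point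
  of this support witnesses that identifying \<open>j\<close> with \<open>k\<close> loses neither the merged variable nor \<open>i\<close>, and
  not \<open>l\<close> either; since the identification is lossy, it must absorb yet another variable \<open>v\<close>.
\<close>

lemma next_absorber:
  assumes k: "absorbs F i j k" and l: "absorbs F i k l" "l \<in> ess_vars F" "l \<noteq> j"
    and loss: "lossy F j k"
  shows "\<exists>v\<in>ess_vars F. absorbs F j k v \<and> absorbs F i j v \<and> \<not> absorbs F i k v"
proof -
  have lij: "absorbs F i j l"
    using absorbs_trans[OF k l(1)] l(3) absorbs_distinct[OF l(1)] by blast
  obtain x where x: "F (flip l x) \<noteq> F x" using l by (auto simp: ess_vars_def)
  have xij: "x i \<noteq> x j" and xik: "x i \<noteq> x k"
    using x absorbsD[OF lij] absorbsD[OF l(1)] by blast+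
  then have xjk: "x j = x k" by (metis bit_neq_iff)
  have lj': "i \<noteq> j" "l \<noteq> j" "j \<noteq> l" "i \<noteq> l" "k \<noteq> l" "i \<noteq> k" "j \<noteq> k"
    using l(3) absorbs_distinct[OF l(1)] absorbs_distinct[OF k] by auto
  \<comment> \<open>Flipping \<open>j\<close> and \<open>k\<close> would move the support point \<open>x\<close> to one with equal bits at \<open>i\<close> and \<open>j\<close>, where \<open>l\<close> is irrelevant.\<close>
  have "\<not> cancels F j k"
  proof
    let ?y = "flip j (flip k x)"
    assume c: "cancels F j k"
    have "F ?y = F x" using c xjk by (simp add: cancels_def)
    moreover have "F (flip j (flip k (flip l x))) = F (flip l x)"
      using c xjk lj' by (simp add: cancels_def)
    moreover have "F (flip l ?y) = F ?y"
      using xij lj' by (intro absorbsD[OF lij]) (simp add: bit_neq_iff)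
    ultimately show False using x by (simp add: flip_commute)
  qed
  then obtain v where v: "v \<in> ess_vars F" "absorbs F j k v"
    using loss by (auto simp: lossy_def)
  have "v \<noteq> i"
  proof
    assume "v = i"
    with v have i: "absorbs F j k i" by simp
    have "F (flip i x) = F x" using xjk by (rule absorbsD[OF i])
    moreover have "F (flip i (flip l x)) = F (flip l x)"
      using xjk lj' by (intro absorbsD[OF i]) simp
    moreover have "F (flip l (flip i x)) = F (flip i x)"
      using xij lj' by (intro absorbsD[OF lij]) (simp add: bit_neq_iff)
    ultimately show False using x by (simp add: flip_commute)
  qed
  then have vij: "absorbs F i j v"
    using absorbs_trans[OF k v(2)] absorbs_distinct[OF v(2)] by blast
  then have "\<not> absorbs F i k v"
    using no_absorbing_triangle[OF vij v(2)] v(1) by blast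
  with v vij show ?thesis by blast
qed

section \<open>Existence of an absorber makes the function a majority\<close>

definition absorbers :: "((nat \<Rightarrow> bit) \<Rightarrow> bit) \<Rightarrow> nat \<Rightarrow> nat \<Rightarrow> nat set" where
  "absorbers F i j = {k \<in> ess_vars F. absorbs F i j k}"

text \<open>
  The directed graph on the absorbers of \<open>i, j\<close> in which \<open>k\<close> points to \<open>l\<close> if identifying \<open>k\<close> with \<open>i\<close>
  or with \<open>j\<close> makes \<open>l\<close> inessential.
\<close>

definition successors :: "((nat \<Rightarrow> bit) \<Rightarrow> bit) \<Rightarrow> nat \<Rightarrow> nat \<Rightarrow> nat \<Rightarrow> nat set" where
  "successors F i j k = {l \<in> absorbers F i j. l \<in> absorbers F i k \<or> l \<in> absorbers F j k}"

lemma successors_commute: "successors F i j k = successors F j i k"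
  unfolding successors_def absorbers_def by (auto simp: absorbs_commute)

text \<open>
  Let \<open>A\<close> be the set of those successors of \<open>k\<close> that arise from the pair \<open>i, k\<close>. By transitivity, every
  successor of \<open>l\<close> other than \<open>k\<close> itself lies in \<open>A\<close>, and \<open>l\<close> does not succeed itself; so \<open>l\<close> has at
  most as many successors as \<open>A\<close> has elements. But \<open>k\<close> has in addition a successor from the pair
  \<open>j, k\<close>, by \<open>next_absorber\<close>.
\<close>

lemma card_successors_decreases:
  assumes fin: "finite (ess_vars F)" and k: "k \<in> absorbers F i j"
    and l: "l \<in> absorbers F i k" "l \<noteq> j"
    and loss: "lossy F j k"
  shows "l \<in> absorbers F i j" "card (successors F i j l) < card (successors F i j k)"
proof -
  have k': "absorbs F i j k" and l': "absorbs F i k l" and ess: "k \<in> ess_vars F" "l \<in> ess_vars F"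
    using k l by (auto simp: absorbers_def)
  have lij: "absorbs F i j l"
    using absorbs_trans[OF k' l'] l(2) absorbs_distinct[OF l'] by blast
  then show "l \<in> absorbers F i j"
    using ess by (simp add: absorbers_def)
  obtain v where v: "v \<in> ess_vars F" "absorbs F j k v" "absorbs F i j v" "\<not> absorbs F i k v"
    using next_absorber[OF k' l' ess(2) l(2) loss] by blast
  define A where "A = {m \<in> absorbers F i j. m \<in> absorbers F i k}"
  have fins: "finite (absorbers F a b)" for a b
    using fin by (simp add: absorbers_def)
  have finA: "finite A"
    using fins by (simp add: A_def)
  have lA: "l \<in> A"
    using l(1) lij ess by (simp add: A_def absorbers_def)
  have "successors F i j l \<subseteq> insert k (A - {l})"
  proof
    fix m assume m: "m \<in> successors F i j l"
    then have mS: "m \<in> ess_vars F" "absorbs F i j m" and "absorbs F i l m \<or> absorbs F j l m"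
      by (auto simp: successors_def absorbers_def)
    then obtain a where a: "absorbs F a l m" by blast
    have "absorbs F i k m" if "m \<noteq> k"
      using absorbs_trans[OF l' a] that absorbs_distinct[OF mS(2)] by blast
    then show "m \<in> insert k (A - {l})"
      using absorbs_distinct[OF a] mS by (auto simp: A_def absorbers_def)
  qed
  then have "card (successors F i j l) \<le> card (insert k (A - {l}))"
    using finA by (intro card_mono) auto
  also have "\<dots> \<le> Suc (card (A - {l}))"
    by (simp add: card_insert_le_m1 card_insert_if finA)
  also have "\<dots> = card A"
    using finA lA by (metis card_Suc_Diff1)
  also have "\<dots> < card (successors F i j k)"
  proof (rule psubset_card_mono)
    show "finite (successors F i j k)"
      using fins by (simp add: successors_def)
    have "v \<in> successors F i j k" "v \<notin> A"
      using v by (auto simp: A_def successors_def absorbers_def)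
    moreover have "A \<subseteq> successors F i j k"
      by (auto simp: A_def successors_def)
    ultimately show "A \<subset> successors F i j k" by blast
  qed
  finally show "card (successors F i j l) < card (successors F i j k)" .
qed

text \<open>
  An absorber with the fewest successors has none, because a successor would have fewer still. So
  identifying it with \<open>i\<close> can absorb only \<open>j\<close>, and with \<open>j\<close> only \<open>i\<close>.
\<close>

lemma exists_terminal_absorber:
  assumes fin: "finite (ess_vars F)" and E: "i \<in> ess_vars F" "j \<in> ess_vars F"
    and loss: "\<And>a b. a \<in> ess_vars F \<Longrightarrow> b \<in> ess_vars F \<Longrightarrow> a \<noteq> b \<Longrightarrow> lossy F a b"
    and ne: "absorbers F i j \<noteq> {}"
  shows "\<exists>k \<in> absorbers F i j. absorbers F i k \<subseteq> {j} \<and> absorbers F j k \<subseteq> {i}"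
proof -
  obtain k where k: "k \<in> absorbers F i j"
    and min: "\<And>l. l \<in> absorbers F i j \<Longrightarrow> card (successors F i j k) \<le> card (successors F i j l)"
    using ne ex_min_if_finite arg_min_nat_lemma[of "\<lambda>l. l \<in> absorbers F i j" _ "\<lambda>l. card (successors F i j l)"]
    by (metis ex_in_conv)
  have kd: "k \<in> ess_vars F" "k \<noteq> i" "k \<noteq> j"
    using k absorbs_distinct by (auto simp: absorbers_def)
  have k': "k \<in> absorbers F j i"
    using k by (simp add: absorbers_def absorbs_commute)
  have "l = j" if l: "l \<in> absorbers F i k" for l
    using card_successors_decreases[OF fin k l] min loss[OF E(2) kd(1)] kd by fastforce
  moreover have "l = i" if l: "l \<in> absorbers F j k" for l
    using card_successors_decreases[OF fin k' l] min loss[OF E(1) kd(1)] kd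
    by (fastforce simp: successors_commute absorbers_def absorbs_commute)
  ultimately show ?thesis using k by blast
qed

definition maj :: "bit \<Rightarrow> bit \<Rightarrow> bit \<Rightarrow> bit" where
  "maj a b c = a * b + a * c + b * c"

lemma maj_simps [simp]:
  "maj a a c = a" "maj a b a = a" "maj a b b = b"
  "maj a (a + 1) c = c" "maj (a + 1) a c = c" "maj a b (a + 1) = b" "maj a b (b + 1) = a"
  "maj (a + 1) b a = b" "maj a (b + 1) b = a"
  unfolding maj_def by (cases a; cases b; cases c; simp)+

text \<open>
  Consider \<open>F\<close> as a function of the three bits at \<open>i\<close>, \<open>j\<close>, \<open>k\<close>, all others being held. For each of the
  pairs \<open>i, k\<close> and \<open>j, k\<close> the only possible losses are the merged variable and the third one. If both
  lose the third variable, the value depends only on the majority of the three bits; if both lose the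
  merged variable, the same holds with the bit at \<open>k\<close> negated. In the two mixed cases \<open>k\<close> would be
  inessential.
\<close>

lemma maj_reduction:
  assumes k: "k \<in> absorbers F i j"
    and terminal: "absorbers F i k \<subseteq> {j}" "absorbers F j k \<subseteq> {i}"
    and loss: "lossy F i k" "lossy F j k"
  shows "\<exists>e. \<forall>x. F x = (let c = maj (x i) (x j) (x k + e) in F (x(i := c, j := c, k := c)))"
proof -
  have kE: "k \<in> ess_vars F" and kij: "absorbs F i j k"
    using k by (auto simp: absorbers_def)
  note [simp] = absorbs_distinct[OF kij] absorbs_distinct[OF kij, THEN conjunct1, symmetric]
    absorbs_distinct[OF kij, THEN conjunct2, THEN conjunct1, symmetric]
    absorbs_distinct[OF kij, THEN conjunct2, THEN conjunct2, symmetric]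
  define V where "V = (\<lambda>x a b c. F (x(i := a, j := b, k := c)))"
  have FV: "F x = V x (x i) (x j) (x k)" for x
    by (simp add: V_def)
  have flipV: "flip i (x(i := a, j := b, k := c)) = x(i := a + 1, j := b, k := c)"
    "flip j (x(i := a, j := b, k := c)) = x(i := a, j := b + 1, k := c)"
    "flip k (x(i := a, j := b, k := c)) = x(i := a, j := b, k := c + 1)" for x a b c
    by (auto simp: flip_def fun_eq_iff)
  have K: "V x a a (c + 1) = V x a a c" for x a c
    using absorbsD[OF kij, of "x(i := a, j := a, k := c)"] by (simp add: V_def flipV)
  have ik: "cancels F i k \<or> absorbs F i k j"
    using loss(1) terminal(1) by (auto simp: lossy_def absorbers_def)
  have jk: "cancels F j k \<or> absorbs F j k i"
    using loss(2) terminal(2) by (auto simp: lossy_def absorbers_def)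
  have absorbI: "V x a (b + 1) a = V x a b a" if "absorbs F i k j" for x a b
    using absorbsD[OF that, of "x(i := a, j := b, k := a)"] by (simp add: V_def flipV)
  have absorbJ: "V x (a + 1) b b = V x a b b" if "absorbs F j k i" for x a b
    using absorbsD[OF that, of "x(i := a, j := b, k := b)"] by (simp add: V_def flipV)
  have cancelI: "V x (a + 1) b (a + 1) = V x a b a" if "cancels F i k" for x a b
    using that[unfolded cancels_def, rule_format, of "x(i := a, j := b, k := a)"]
    by (simp add: V_def flipV)
  have cancelJ: "V x a (b + 1) (b + 1) = V x a b b" if "cancels F j k" for x a b
    using that[unfolded cancels_def, rule_format, of "x(i := a, j := b, k := b)"]
    by (simp add: V_def flipV)
  have absurd: False if "\<And>x a c. V x a (a + 1) (c + 1) = V x a (a + 1) c"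
  proof -
    have "V x a b (c + 1) = V x a b c" for x a b c
    proof (cases "b = a")
      case False
      then have "b = a + 1" by (simp only: bit_neq_iff)
      with that show ?thesis by simp
    qed (simp add: K)
    moreover obtain x where "F (flip k x) \<noteq> F x"
      using kE by (auto simp: ess_vars_def)
    moreover have "F (flip k x) = V x (x i) (x j) (x k + 1)" for x
      by (simp add: V_def flip_def)
    ultimately show False
      by (simp add: FV)
  qed
  \<comment> \<open>\<open>e\<close> is \<open>1\<close> if both pairs cancel and \<open>0\<close> if both absorb; \<open>absurd\<close> excludes the mixed cases.\<close>
  have red: "\<exists>e. \<forall>x a b c. V x a b c = (let d = maj a b (c + e) in V x d d d)"
    using ik jk
  proof (elim disjE)
    assume "cancels F i k" "cancels F j k"
    then have "V x a b c = (let d = maj a b (c + 1) in V x d d d)" for x a b c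
      using K[of x 0 0] K[of x 1 0] cancelI[of x 0 0] cancelI[of x 0 1] cancelJ[of x 0 0] cancelJ[of x 1 0]
      by (cases a; cases b; cases c; simp add: maj_def)
    then show ?thesis by blast
  next
    assume "absorbs F i k j" "absorbs F j k i"
    then have "V x a b c = (let d = maj a b (c + 0) in V x d d d)" for x a b c
      using K[of x 0 0] K[of x 1 0] absorbI[of x 0 0] absorbI[of x 1 0] absorbJ[of x 0 0] absorbJ[of x 0 1]
      by (cases a; cases b; cases c; simp add: maj_def)
    then show ?thesis by blast
  next
    assume "cancels F i k" "absorbs F j k i"
    then have "V x a (a + 1) (c + 1) = V x a (a + 1) c" for x a c
      using K[of x 0 0] K[of x 1 0] cancelI[of x 0 0] cancelI[of x 0 1] absorbJ[of x 0 0] absorbJ[of x 0 1]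
      by (cases a; cases c; simp)
    then show ?thesis using absurd by blast
  next
    assume "absorbs F i k j" "cancels F j k"
    then have "V x a (a + 1) (c + 1) = V x a (a + 1) c" for x a c
      using K[of x 0 0] K[of x 1 0] absorbI[of x 0 0] absorbI[of x 1 0] cancelJ[of x 0 0] cancelJ[of x 1 0]
      by (cases a; cases c; simp)
    then show ?thesis using absurd by blast
  qed
  then obtain e where e: "\<And>x a b c. V x a b c = (let d = maj a b (c + e) in V x d d d)" by blast
  show ?thesis
    by (rule exI[of _ e], rule allI, subst FV, subst e) (simp add: V_def Let_def)
qed

text \<open>
  With majority behaviour in \<open>i\<close>, \<open>j\<close>, \<open>k\<close>, fixing the bit at \<open>k\<close> to that at \<open>l\<close> leaves enough freedom
  in \<open>i\<close> and \<open>j\<close>: setting both to \<open>c\<close> produces majority \<open>c\<close>, and setting them to different values still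
  lets the third bit decide. So identifying \<open>k\<close> with \<open>l\<close> destroys no further variable.
\<close>

lemma no_fourth_variable:
  assumes red: "\<And>x. F x = (let c = maj (x i) (x j) (x k + e) in F (x(i := c, j := c, k := c)))"
    and dist: "i \<noteq> j" "k \<noteq> i" "k \<noteq> j" and k: "k \<in> ess_vars F"
    and l: "l \<notin> {i, j, k}"
    and loss: "lossy F k l"
  shows False
proof -
  define G where "G = (\<lambda>c x. F (x(i := c, j := c, k := c)))"
  have FG: "F x = G (maj (x i) (x j) (x k + e)) x" for x
    unfolding G_def using red[of x] by (simp add: Let_def)
  have G_upd: "G c (x(v := b)) = G c x" if "v \<in> {i, j, k}" for c x v b
  proof -
    have "x(v := b, i := c, j := c, k := c) = x(i := c, j := c, k := c)"
      using that by (auto simp: fun_eq_iff)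
    then show ?thesis by (simp add: G_def)
  qed
  have G_flip: "G c (flip v x) = G c x" if "v \<in> {i, j, k}" for c x v
    using G_upd[OF that] by (simp add: flip_def)
  have neq: "i \<noteq> l" "j \<noteq> l" "k \<noteq> l" "l \<noteq> i" "l \<noteq> j" "l \<noteq> k" "j \<noteq> i" "i \<noteq> k" "j \<noteq> k"
    using l dist by auto
  note [simp] = dist neq
  obtain x where "F (flip k x) \<noteq> F x"
    using k by (auto simp: ess_vars_def)
  moreover have "F (flip k x) = F x" if "G 0 x = G 1 x"
  proof -
    have "G a x = G b x" for a b
      using that by (cases a; cases b; simp)
    then show ?thesis
      by (simp only: FG[of x] FG[of "flip k x"] G_flip insert_iff simp_thms)
  qed
  ultimately have x01: "G 0 x \<noteq> G 1 x" by blast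
  \<comment> \<open>Assignments on the diagonal of \<open>k\<close> and \<open>l\<close> with prescribed bits at \<open>i\<close> and \<open>j\<close>.\<close>
  define y where "y = (\<lambda>a b. x(k := x l, i := a, j := b))"
  have y_simps [simp]: "y a b i = a" "y a b j = b" "y a b k = x l" "y a b l = x l"
    and Gy: "G c (y a b) = G c x" for a b c
    by (simp_all add: y_def G_upd)
  from loss show False unfolding lossy_def
  proof (elim disjE bexE)
    assume c: "cancels F k l"
    have *: "G (maj a b (x l + 1 + e)) (flip l x) = G (maj a b (x l + e)) x" for a b
    proof -
      have 1: "F (flip k (flip l (y a b))) = F (y a b)"
        using c by (simp add: cancels_def)
      have "G d (flip l (y a b)) = G d (flip l x)" for d
      proof -
        have "flip l (y a b) = (flip l x)(k := x l, i := a, j := b)"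
          by (auto simp: y_def flip_def fun_eq_iff)
        then show ?thesis by (simp add: G_upd)
      qed
      with 1 show ?thesis
        by (simp add: FG[of "y a b"] FG[of "flip k (flip l (y a b))"] G_flip Gy)
    qed
    have "G c (flip l x) = G c x" for c
      using *[of c c] by simp
    with *[of 0 1] x01 show False
      by (cases "x l"; cases e; simp add: maj_def)
  next
    fix m assume m: "m \<in> ess_vars F" "absorbs F k l m"
    then have m': "m \<noteq> k" "m \<noteq> l" using absorbs_distinct by blast+
    show False
    proof (cases "m \<in> {i, j}")
      case True
      \<comment> \<open>With this value at \<open>i\<close> and \<open>j\<close>, the third argument of the majority is the opposite bit, so flipping \<open>m\<close> turns the majority.\<close>
      define b where "b = x l + e + 1"
      have "F (flip m (y b b)) = F (y b b)"
        by (rule absorbsD[OF m(2)]) simp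
      moreover have "F (flip m (y b b)) = G (x l + e) x"
        using True by (subst FG) (auto simp: G_flip Gy)
      moreover have "F (y b b) = G b x"
        by (simp add: FG[of "y b b"] Gy)
      ultimately have "G (x l + e) x = G (x l + e + 1) x"
        by (simp add: b_def)
      with x01 show False
        by (cases "x l + e"; simp)
    next
      case False
      obtain z where z: "F (flip m z) \<noteq> F z"
        using m(1) by (auto simp: ess_vars_def)
      define c where "c = maj (z i) (z j) (z k + e)"
      \<comment> \<open>Moves \<open>z\<close> onto the diagonal of \<open>k\<close> and \<open>l\<close> while forcing its majority to stay \<open>c\<close>.\<close>
      define w where "w = z(k := z l, i := c, j := c)"
      have mn: "i \<noteq> m" "j \<noteq> m" "k \<noteq> m" "l \<noteq> m"
        using False m' by auto
      have w_simps [simp]: "w i = c" "w j = c" "w k = z l" "w l = z l"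
        by (simp_all add: w_def)
      have fw: "flip m w = (flip m z)(k := z l, i := c, j := c)"
        using mn by (auto simp: w_def flip_def fun_eq_iff)
      have "F (flip m w) = F w"
        by (rule absorbsD[OF m(2)]) simp
      moreover have "F w = G c z"
        by (simp add: FG[of w]) (simp add: w_def G_upd)
      moreover have "F (flip m w) = G c (flip m z)"
        using mn by (simp add: FG[of "flip m w"]) (simp add: fw G_upd)
      moreover have "F z = G c z" "F (flip m z) = G c (flip m z)"
        using mn by (simp_all add: FG[of z] FG[of "flip m z"] c_def)
      ultimately show False using z by simp
    qed
  qed
qed

lemma absorber_imp_maj:
  assumes E: "finite (ess_vars F)" "i \<in> ess_vars F" "j \<in> ess_vars F"
    and loss: "\<And>a b. a \<in> ess_vars F \<Longrightarrow> b \<in> ess_vars F \<Longrightarrow> a \<noteq> b \<Longrightarrow> lossy F a b"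
    and dep: "depends_only_on F (ess_vars F)"
    and ne: "absorbers F i j \<noteq> {}"
  shows "\<exists>k\<in>ess_vars F. \<exists>e c. i \<noteq> j \<and> k \<noteq> i \<and> k \<noteq> j \<and> (\<forall>x. F x = maj (x i) (x j) (x k + e) + c)"
proof -
  obtain k where k: "k \<in> absorbers F i j" and terminal: "absorbers F i k \<subseteq> {j}" "absorbers F j k \<subseteq> {i}"
    using exists_terminal_absorber[OF E loss ne] by blast
  then have kE: "k \<in> ess_vars F" and d: "i \<noteq> j" "k \<noteq> i" "k \<noteq> j"
    using absorbs_distinct[of F i j k] by (auto simp: absorbers_def)
  obtain e where e: "\<And>x. F x = (let c = maj (x i) (x j) (x k + e) in F (x(i := c, j := c, k := c)))"
    using maj_reduction[OF k terminal] loss E kE d by metis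
  have sub: "ess_vars F \<subseteq> {i, j, k}"
  proof
    fix l assume l: "l \<in> ess_vars F"
    show "l \<in> {i, j, k}"
    proof (rule ccontr)
      assume l': "l \<notin> {i, j, k}"
      then show False
        using no_fourth_variable[OF e d kE l' loss] kE l by blast
    qed
  qed
  define h where "h = (\<lambda>b::bit. F (\<lambda>_. b))"
  have Fh: "F x = h (maj (x i) (x j) (x k + e))" for x
  proof -
    define c where "c = maj (x i) (x j) (x k + e)"
    have "F (x(i := c, j := c, k := c)) = F (\<lambda>_. c)"
      by (rule depends_only_onD[OF dep]) (use sub in auto)
    then show ?thesis using e[of x] by (simp add: h_def c_def Let_def)
  qed
  \<comment> \<open>A nonconstant function of one bit is the identity up to a constant.\<close>
  have "h 0 \<noteq> h 1"
  proof
    assume "h 0 = h 1"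
    then have "h a = h b" for a b by (cases a; cases b; simp)
    with kE show False by (auto simp: ess_vars_def Fh)
  qed
  then have "h b = b + h 0" for b
    by (cases b) (auto simp: bit_neq_iff add.commute)
  with Fh kE d show ?thesis by metis
qed

section \<open>Without absorbers: parities and functions of two variables\<close>

text \<open>
  Unequal bits at \<open>i\<close> and \<open>j\<close> are flipped in two moves, each of which flips two equal bits: one of them
  agrees with the bit at \<open>l\<close>, and after these two have been flipped, the bit at \<open>l\<close> agrees with the
  other one.
\<close>

lemma cancels_imp_double_flip:
  assumes canc: "\<And>a b. a \<in> E \<Longrightarrow> b \<in> E \<Longrightarrow> a \<noteq> b \<Longrightarrow> cancels F a b"
    and three: "i \<in> E" "j \<in> E" "l \<in> E" "i \<noteq> j" "l \<noteq> i" "l \<noteq> j"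
  shows "F (flip i (flip j x)) = F x"
proof -
  have *: "F (flip a (flip b x)) = F x"
    if "a \<in> E" "b \<in> E" "a \<noteq> b" "l \<noteq> a" "l \<noteq> b" "x a \<noteq> x b" "x l = x a" for a b
  proof -
    have "F (flip l (flip b (flip a (flip l x)))) = F (flip a (flip l x))"
      using canc[of l b] that three
      by (simp add: cancels_def bit_neq_iff add.assoc)
    moreover have "F (flip a (flip l x)) = F x"
      using canc[of a l] that three by (simp add: cancels_def)
    moreover have "flip l (flip b (flip a (flip l x))) = flip a (flip b x)"
      by (metis flip_flip flip_commute)
    ultimately show ?thesis by simp
  qed
  consider "x i = x j" | "x i \<noteq> x j" "x l = x i" | "x j \<noteq> x i" "x l = x j"
    by (cases "x i"; cases "x j"; cases "x l"; simp)
  then show ?thesis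
  proof cases
    case 1
    then show ?thesis using canc three by (simp add: cancels_def)
  next
    case 2
    then show ?thesis using *[of i j] three by simp
  next
    case 3
    then show ?thesis using *[of j i] three by (simp add: flip_commute)
  qed
qed

lemma flip_sum:
  "finite I \<Longrightarrow> (\<Sum>i\<in>I. flip k x i) = (\<Sum>i\<in>I. x i) + of_bool (k \<in> I)"
  by (induction I rule: finite_induct) (auto simp: flip_def ac_simps)

text \<open>
  The derivative with respect to any essential variable is invariant under all flips, hence constantly
  \<open>1\<close>; so adding the parity of the essential variables to \<open>F\<close> gives a constant.
\<close>

lemma parity_of_double_flip:
  assumes fin: "finite (ess_vars F)" and dep: "depends_only_on F (ess_vars F)"
    and dbl: "\<And>i j x. i \<in> ess_vars F \<Longrightarrow> j \<in> ess_vars F \<Longrightarrow> i \<noteq> j \<Longrightarrow> F (flip i (flip j x)) = F x"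
  shows "\<exists>c. \<forall>x. F x = (\<Sum>i\<in>ess_vars F. x i) + c"
proof -
  have depI: "depends_only_on (\<lambda>x. F (flip i x) + F x) (ess_vars F)" for i
    unfolding depends_only_on_def
  proof (intro allI impI)
    fix x y :: "nat \<Rightarrow> bit" assume eq: "\<forall>i\<in>ess_vars F. x i = y i"
    have "F x = F y" "F (flip i x) = F (flip i y)"
      by (rule depends_only_onD[OF dep]; use eq in \<open>auto simp: flip_def\<close>)+
    then show "F (flip i x) + F x = F (flip i y) + F y" by simp
  qed
  have step: "F (flip i x) = F x + 1" if i: "i \<in> ess_vars F" for i x
  proof -
    define d where "d = (\<lambda>x. F (flip i x) + F x)"
    have dd: "depends_only_on d (ess_vars F)" using depI by (simp add: d_def)
    have "d (flip j x) = d x" if j: "j \<in> ess_vars F" for j x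
    proof (cases "j = i")
      case False
      then have "F (flip i (flip j x)) = F x" using dbl[OF i j] by simp
      moreover have "F (flip j x) = F (flip i x)"
        using dbl[OF i j, of "flip i x"] False by (simp add: flip_commute[of j i])
      ultimately show ?thesis by (simp add: d_def add.commute)
    qed (simp add: d_def add.commute)
    then have "j \<notin> ess_vars d" if "j \<in> ess_vars F" for j
      using that by (simp add: ess_vars_def)
    then have "ess_vars d = {}"
      using ess_vars_subset[OF dd] by blast
    then have "depends_only_on d {}"
      using depends_only_on_ess_vars[OF fin dd] by simp
    then have "d x = d y" for x y by (rule depends_only_on_empty)
    moreover obtain y where "F (flip i y) \<noteq> F y" using i by (auto simp: ess_vars_def)
    then have "d y = 1" by (simp add: d_def bit_neq_iff ac_simps)
    ultimately have "d x = 1" by metis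
    then show ?thesis by (cases "F x"; cases "F (flip i x)"; simp add: d_def)
  qed
  define H where "H = (\<lambda>x. F x + (\<Sum>i\<in>ess_vars F. x i))"
  have "depends_only_on H (ess_vars F)"
    unfolding depends_only_on_def H_def
    by (auto intro!: arg_cong2[where f = "(+)"] sum.cong depends_only_onD[OF dep])
  moreover have "H (flip i x) = H x" if "i \<in> ess_vars F" for i x
    using that by (simp add: H_def step flip_sum[OF fin] add.left_commute add.commute)
  then have "i \<notin> ess_vars H" if "i \<in> ess_vars F" for i
    using that by (simp add: ess_vars_def)
  ultimately have "depends_only_on H (ess_vars F)" "ess_vars H = {}"
    using ess_vars_subset[of H "ess_vars F"] by blast+
  then have "depends_only_on H {}"
    using depends_only_on_ess_vars[OF fin, of H] by simp
  then have "H x = H (\<lambda>_. 0)" for x by (rule depends_only_on_empty)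
  then have "F x = (\<Sum>i\<in>ess_vars F. x i) + H (\<lambda>_. 0)" for x
    by (metis H_def bit_add_self_left add.commute)
  then show ?thesis by blast
qed

lemma two_variables_cancelling:
  assumes E: "ess_vars F = {i, j}" "i \<noteq> j" and dep: "depends_only_on F (ess_vars F)"
    and canc: "cancels F i j"
  shows "\<exists>c. (\<forall>x. F x = (\<Sum>i\<in>ess_vars F. x i) + c) \<or> (\<forall>x. F x = x i * x j + x i + c)
           \<or> (\<forall>x. F x = x j * x i + x j + c)"
proof -
  define v where "v = (\<lambda>a b. F ((\<lambda>_. 0)(i := a, j := b)))"
  have Fv: "F x = v (x i) (x j)" for x
    unfolding v_def by (rule depends_only_onD[OF dep]) (use E in auto)
  have "F (flip i (flip j (\<lambda>_. 0))) = F (\<lambda>_. 0)"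
    using canc by (simp add: cancels_def)
  then have v11: "v 1 1 = v 0 0" using E(2) by (simp add: Fv)
  define c where "c = v 0 0"
  have nc: "v 1 0 \<noteq> c \<or> v 0 1 \<noteq> c"
  proof (rule ccontr)
    assume "\<not> ?thesis"
    then have "v a b = c" for a b
      using v11 by (cases a; cases b; simp add: c_def)
    then have "ess_vars F = {}" by (simp add: ess_vars_def Fv)
    with E show False by simp
  qed
  then consider "v 1 0 = c + 1" "v 0 1 = c + 1" | "v 1 0 = c + 1" "v 0 1 = c" | "v 1 0 = c" "v 0 1 = c + 1"
    by (metis bit_neq_iff)
  then show ?thesis
  proof cases
    case 1
    then have "v a b = a + b + c" for a b
      using v11 by (cases a; cases b; simp add: c_def ac_simps)
    then have "\<forall>x. F x = (\<Sum>i\<in>ess_vars F. x i) + c"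
      using E by (simp add: Fv)
    then show ?thesis by blast
  next
    case 2
    then have "v a b = a * b + a + c" for a b
      using v11 by (cases a; cases b; simp add: c_def ac_simps)
    then have "\<forall>x. F x = x i * x j + x i + c"
      by (simp add: Fv)
    then show ?thesis by blast
  next
    case 3
    then have "v a b = b * a + b + c" for a b
      using v11 by (cases a; cases b; simp add: c_def ac_simps)
    then have "\<forall>x. F x = x j * x i + x j + c"
      by (simp add: Fv)
    then show ?thesis by blast
  qed
qed

section \<open>Functions all of whose identifications are lossy\<close>

text \<open>
  The functions given by the special Zhegalkin polynomials. The last two families become one:
  \<open>x\<^sub>i x\<^sub>j + x\<^sub>i x\<^sub>k + x\<^sub>j x\<^sub>k + x\<^sub>i + x\<^sub>j\<close> is the majority of \<open>x\<^sub>i\<close>, \<open>x\<^sub>j\<close> and the negation of \<open>x\<^sub>k\<close>,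
  so \<open>e\<close> tells whether the last argument is negated.
\<close>

definition special_fun :: "nat set \<Rightarrow> ((nat \<Rightarrow> bit) \<Rightarrow> bit) \<Rightarrow> bool" where
  "special_fun V F \<longleftrightarrow> (\<exists>c.
     (\<exists>I. I \<noteq> {} \<and> I \<subseteq> V \<and> (\<forall>x. F x = (\<Sum>i\<in>I. x i) + c)) \<or>
     (\<exists>i\<in>V. \<exists>j\<in>V. i \<noteq> j \<and> (\<forall>x. F x = x i * x j + x i + c)) \<or>
     (\<exists>i\<in>V. \<exists>j\<in>V. \<exists>k\<in>V. i \<noteq> j \<and> i \<noteq> k \<and> j \<noteq> k \<and>
        (\<exists>e. \<forall>x. F x = maj (x i) (x j) (x k + e) + c)))"

lemma special_fun_parity:
  "I \<noteq> {} \<Longrightarrow> I \<subseteq> V \<Longrightarrow> \<forall>x. F x = (\<Sum>i\<in>I. x i) + c \<Longrightarrow> special_fun V F"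
  unfolding special_fun_def by (rule exI[of _ c], rule disjI1, rule exI[of _ I], simp)

lemma special_fun_quadratic:
  "i \<in> V \<Longrightarrow> j \<in> V \<Longrightarrow> i \<noteq> j \<Longrightarrow> \<forall>x. F x = x i * x j + x i + c \<Longrightarrow> special_fun V F"
  unfolding special_fun_def
  by (rule exI[of _ c], rule disjI2, rule disjI1, rule bexI[of _ i], rule bexI[of _ j], simp_all)

lemma special_fun_maj:
  "i \<in> V \<Longrightarrow> j \<in> V \<Longrightarrow> k \<in> V \<Longrightarrow> i \<noteq> j \<Longrightarrow> i \<noteq> k \<Longrightarrow> j \<noteq> k \<Longrightarrow>
    \<forall>x. F x = maj (x i) (x j) (x k + e) + c \<Longrightarrow> special_fun V F"
  unfolding special_fun_def
  by (rule exI[of _ c], rule disjI2, rule disjI2, rule bexI[of _ i], rule bexI[of _ j],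
      rule bexI[of _ k], intro conjI, simp_all, rule exI[of _ e], simp)

lemma special_fun_mono: "special_fun V F \<Longrightarrow> V \<subseteq> W \<Longrightarrow> special_fun W F"
  unfolding special_fun_def by (smt (verit) subset_iff subset_trans)

theorem all_lossy_imp_special:
  assumes fin: "finite (ess_vars F)" and dep: "depends_only_on F (ess_vars F)"
    and two: "2 \<le> card (ess_vars F)"
    and loss: "\<And>a b. a \<in> ess_vars F \<Longrightarrow> b \<in> ess_vars F \<Longrightarrow> a \<noteq> b \<Longrightarrow> lossy F a b"
  shows "special_fun (ess_vars F) F"
proof (cases "\<exists>i\<in>ess_vars F. \<exists>j\<in>ess_vars F. absorbers F i j \<noteq> {}")
  case True
  then obtain i j where ij: "i \<in> ess_vars F" "j \<in> ess_vars F" "absorbers F i j \<noteq> {}" by blast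
  from absorber_imp_maj[OF fin ij(1,2) loss dep ij(3)]
  obtain k e c where "k \<in> ess_vars F" "i \<noteq> j" "k \<noteq> i" "k \<noteq> j"
    "\<forall>x. F x = maj (x i) (x j) (x k + e) + c" by blast
  with ij(1,2) show ?thesis
    by (intro special_fun_maj[of i _ j k _ e c]) auto
next
  case False
  then have canc: "cancels F a b" if "a \<in> ess_vars F" "b \<in> ess_vars F" "a \<noteq> b" for a b
    using that loss[OF that] by (auto simp: lossy_def absorbers_def)
  have ne: "ess_vars F \<noteq> {}" using two by auto
  show ?thesis
  proof (cases "card (ess_vars F) = 2")
    case True
    then obtain i j where ij: "ess_vars F = {i, j}" "i \<noteq> j"
      by (auto simp: card_2_iff)
    then have "cancels F i j" using canc by simp
    from two_variables_cancelling[OF ij dep this] show ?thesis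
      using special_fun_parity[OF ne subset_refl] special_fun_quadratic[of i _ j] special_fun_quadratic[of j _ i] ij
      by (elim exE disjE) simp_all
  next
    case False
    have "F (flip i (flip j x)) = F x"
      if ij: "i \<in> ess_vars F" "j \<in> ess_vars F" "i \<noteq> j" for i j x
    proof -
      have "\<not> ess_vars F \<subseteq> {i, j}"
        using two False ij card_mono[of "{i, j}" "ess_vars F"] by auto
      then obtain l where "l \<in> ess_vars F" "l \<noteq> i" "l \<noteq> j" by blast
      with cancels_imp_double_flip[OF canc] ij show ?thesis by blast
    qed
    from parity_of_double_flip[OF fin dep this] show ?thesis
      using special_fun_parity[OF ne subset_refl] by blast
  qed
qed

section \<open>Identification minors and their essential variables\<close>

definition identify :: "nat \<Rightarrow> nat \<Rightarrow> ((nat \<Rightarrow> bit) \<Rightarrow> bit) \<Rightarrow> (nat \<Rightarrow> bit) \<Rightarrow> bit" where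
  "identify i j F x = F (x(i := x j))"

lemma ess_vars_identify_iff:
  assumes "i \<noteq> j"
  shows "i \<notin> ess_vars (identify i j F)"
    and "j \<in> ess_vars (identify i j F) \<longleftrightarrow> \<not> cancels F i j"
    and "k \<noteq> i \<Longrightarrow> k \<noteq> j \<Longrightarrow> k \<in> ess_vars (identify i j F) \<longleftrightarrow> \<not> absorbs F i j k"
proof -
  have id: "x(i := x j) = x" if "x i = x j" for x :: "nat \<Rightarrow> bit"
    using that by (simp add: fun_upd_idem)
  have "identify i j F (flip i x) = identify i j F x" for x
    using assms by (simp add: identify_def flip_def)
  then show "i \<notin> ess_vars (identify i j F)"
    by (simp add: ess_vars_def)
  have flipj: "identify i j F (flip j x) = F (flip i (flip j (x(i := x j))))" for x
    using assms by (auto simp: identify_def flip_def fun_upd_twist intro!: arg_cong[where f = F])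
  show "j \<in> ess_vars (identify i j F) \<longleftrightarrow> \<not> cancels F i j"
  proof
    assume "j \<in> ess_vars (identify i j F)"
    then obtain x where "identify i j F (flip j x) \<noteq> identify i j F x"
      by (auto simp: ess_vars_def)
    then show "\<not> cancels F i j"
      using assms unfolding flipj cancels_def
      by (auto simp: identify_def intro!: exI[of _ "x(i := x j)"])
  next
    assume "\<not> cancels F i j"
    then obtain x where "x i = x j" "F (flip i (flip j x)) \<noteq> F x"
      by (auto simp: cancels_def)
    then show "j \<in> ess_vars (identify i j F)"
      using id[of x] flipj[of x] by (auto simp: ess_vars_def identify_def intro!: exI[of _ x])
  qed
  assume k: "k \<noteq> i" "k \<noteq> j"
  have flipk: "identify i j F (flip k x) = F (flip k (x(i := x j)))" for x
    using k by (auto simp: identify_def flip_def fun_upd_twist)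
  show "k \<in> ess_vars (identify i j F) \<longleftrightarrow> \<not> absorbs F i j k"
  proof
    assume "k \<in> ess_vars (identify i j F)"
    then obtain x where "identify i j F (flip k x) \<noteq> identify i j F x"
      by (auto simp: ess_vars_def)
    then show "\<not> absorbs F i j k"
      using assms unfolding flipk absorbs_def
      by (auto simp: identify_def intro!: exI[of _ "x(i := x j)"])
  next
    assume "\<not> absorbs F i j k"
    then obtain x where "x i = x j" "F (flip k x) \<noteq> F x"
      using k assms by (auto simp: absorbs_def)
    then show "k \<in> ess_vars (identify i j F)"
      using id[of x] flipk[of x] by (auto simp: ess_vars_def identify_def intro!: exI[of _ x])
  qed
qed

lemma ess_vars_identify_subset:
  assumes "i \<noteq> j" "j \<in> ess_vars F"
  shows "ess_vars (identify i j F) \<subseteq> ess_vars F - {i}"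
proof
  fix k assume k: "k \<in> ess_vars (identify i j F)"
  then have ki: "k \<noteq> i" using ess_vars_identify_iff(1)[OF assms(1)] by blast
  have "k \<in> ess_vars F" if "k \<noteq> j"
    using ess_vars_identify_iff(3)[OF assms(1) ki that] k ki that assms(1)
    by (auto simp: absorbs_def ess_vars_def)
  then show "k \<in> ess_vars F - {i}"
    using ki assms(2) by blast
qed

text \<open>
  Since the minor has no essential variable outside \<open>ess_vars F - {i}\<close>, losing something beyond \<open>i\<close> is
  the same as having at least two essential variables fewer than \<open>F\<close>.
\<close>

lemma card_ess_vars_identify:
  assumes fin: "finite (ess_vars F)" and ij: "i \<in> ess_vars F" "j \<in> ess_vars F" "i \<noteq> j"
  shows "card (ess_vars (identify i j F)) < card (ess_vars F)"
    and "lossy F i j \<longleftrightarrow> card (ess_vars (identify i j F)) + 2 \<le> card (ess_vars F)"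
proof -
  let ?I = "ess_vars (identify i j F)" and ?E = "ess_vars F - {i}"
  note sub = ess_vars_identify_subset[OF ij(3,2)]
  have cE: "Suc (card ?E) = card (ess_vars F)"
    using fin ij by (metis card_Suc_Diff1)
  have le: "card ?I \<le> card ?E"
    using sub fin by (intro card_mono) auto
  then show "card ?I < card (ess_vars F)" using cE by simp
  have eq: "card ?I = card ?E \<longleftrightarrow> ?I = ?E"
    using sub fin card_subset_eq[of ?E ?I] by auto
  have "lossy F i j \<longleftrightarrow> ?I \<noteq> ?E"
  proof
    assume "lossy F i j"
    then show "?I \<noteq> ?E"
      unfolding lossy_def
    proof (elim disjE bexE)
      assume "cancels F i j"
      then have "j \<notin> ?I" using ess_vars_identify_iff(2)[OF ij(3)] by blast
      with ij show ?thesis by blast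
    next
      fix k assume k: "k \<in> ess_vars F" "absorbs F i j k"
      then have "k \<notin> ?I" "k \<noteq> i"
        using ess_vars_identify_iff(3)[OF ij(3)] absorbs_distinct by blast+
      with k show ?thesis by blast
    qed
  next
    assume "?I \<noteq> ?E"
    then obtain k where k: "k \<in> ?E" "k \<notin> ?I" using sub by blast
    then show "lossy F i j"
      using ess_vars_identify_iff[OF ij(3)] unfolding lossy_def by (cases "k = j") auto
  qed
  then show "lossy F i j \<longleftrightarrow> card ?I + 2 \<le> card (ess_vars F)"
    using eq le cE by linarith
qed

lemma lossy_commute: "lossy F i j \<longleftrightarrow> lossy F j i"
  unfolding lossy_def by (simp add: cancels_commute[of F i] absorbs_commute[of F i])

text \<open>
  This lemma and the two after it show, family by family, that every identification loses at least two
  variables and some identification loses exactly two. Here, identifying two variables removes both of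
  them from the sum.
\<close>

lemma parity_identifications:
  assumes fin: "finite I" and F: "\<And>x. F x = (\<Sum>i\<in>I. x i) + c" and two: "2 \<le> card (ess_vars F)"
  shows "\<forall>a\<in>ess_vars F. \<forall>b\<in>ess_vars F. a \<noteq> b \<longrightarrow> lossy F a b"
    and "\<exists>a\<in>ess_vars F. \<exists>b\<in>ess_vars F. a \<noteq> b \<and> card (ess_vars F) \<le> card (ess_vars (identify a b F)) + 2"
proof -
  have fl: "F (flip k x) = F x + of_bool (k \<in> I)" for k x
    by (simp add: F flip_sum[OF fin] ac_simps)
  then have E: "ess_vars F = I"
    by (auto simp: ess_vars_def)
  show "\<forall>a\<in>ess_vars F. \<forall>b\<in>ess_vars F. a \<noteq> b \<longrightarrow> lossy F a b"
    by (simp add: E lossy_def cancels_def fl add.assoc)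
  from two obtain a b where ab: "a \<in> I" "b \<in> I" "a \<noteq> b"
    unfolding E numeral_2_eq_2 card_le_Suc_iff by auto
  have "I - {a, b} \<subseteq> ess_vars (identify a b F)"
  proof
    fix k assume "k \<in> I - {a, b}"
    then have k: "k \<in> I" "k \<noteq> a" "k \<noteq> b" by auto
    have "\<not> absorbs F a b k"
      using k absorbsD[of F a b k "\<lambda>_. 0"] by (auto simp: fl)
    with k show "k \<in> ess_vars (identify a b F)"
      using ess_vars_identify_iff(3)[OF ab(3)] by blast
  qed
  moreover have "finite (ess_vars (identify a b F))"
    using finite_subset[OF ess_vars_identify_subset[OF ab(3)]] ab fin E by simp
  ultimately have "card (I - {a, b}) \<le> card (ess_vars (identify a b F))"
    by (rule card_mono[rotated])
  moreover have "card (I - {a, b}) = card I - 2"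
    using ab fin by (simp add: card_Diff_subset)
  ultimately show "\<exists>a\<in>ess_vars F. \<exists>b\<in>ess_vars F. a \<noteq> b \<and> card (ess_vars F) \<le> card (ess_vars (identify a b F)) + 2"
    using ab unfolding E by (intro bexI[of _ a] bexI[of _ b]) auto
qed

lemma quadratic_identifications:
  assumes ij: "i \<noteq> j" and F: "\<And>x. F x = x i * x j + x i + c" and two: "2 \<le> card (ess_vars F)"
  shows "\<forall>a\<in>ess_vars F. \<forall>b\<in>ess_vars F. a \<noteq> b \<longrightarrow> lossy F a b"
    and "\<exists>a\<in>ess_vars F. \<exists>b\<in>ess_vars F. a \<noteq> b \<and> card (ess_vars F) \<le> card (ess_vars (identify a b F)) + 2"
proof -
  have "ess_vars F \<subseteq> {i, j}"
    by (rule ess_vars_subset) (simp add: depends_only_on_def F)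
  moreover have "card {i, j} = 2" using ij by simp
  ultimately have E: "ess_vars F = {i, j}"
    using two card_seteq[of "{i, j}" "ess_vars F"] by simp
  have "cancels F i j"
    unfolding cancels_def
  proof (intro allI impI)
    fix x :: "nat \<Rightarrow> bit" assume "x i = x j"
    then show "F (flip i (flip j x)) = F x"
      using ij by (cases "x i"; simp add: F)
  qed
  then have "lossy F i j" by (simp add: lossy_def)
  then show "\<forall>a\<in>ess_vars F. \<forall>b\<in>ess_vars F. a \<noteq> b \<longrightarrow> lossy F a b"
    using lossy_commute[of F i j] by (auto simp: E)
  show "\<exists>a\<in>ess_vars F. \<exists>b\<in>ess_vars F. a \<noteq> b \<and> card (ess_vars F) \<le> card (ess_vars (identify a b F)) + 2"
    using ij by (auto simp: E)
qed

lemma maj_identifications: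
  assumes d: "i \<noteq> j" "i \<noteq> k" "j \<noteq> k" and F: "\<And>x. F x = maj (x i) (x j) (x k + e) + c"
  shows "\<forall>a\<in>ess_vars F. \<forall>b\<in>ess_vars F. a \<noteq> b \<longrightarrow> lossy F a b"
    and "\<exists>a\<in>ess_vars F. \<exists>b\<in>ess_vars F. a \<noteq> b \<and> card (ess_vars F) \<le> card (ess_vars (identify a b F)) + 2"
proof -
  note [simp] = d d[symmetric]
  \<comment> \<open>Balanced inputs: the remaining two arguments of the majority differ, so the flipped one decides.\<close>
  have "F (flip v x) \<noteq> F x" if "v = i \<or> v = j" "x = (\<lambda>_. 0)(k := e + 1)" for v x
    using that by (auto simp: F maj_def add.assoc)
  moreover have "F (flip k x) \<noteq> F x" if "x = (\<lambda>_. 0)(i := 1)" for x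
    using that by (auto simp: F maj_def add.assoc)
  ultimately have "{i, j, k} \<subseteq> ess_vars F"
    unfolding ess_vars_def by blast
  moreover have "ess_vars F \<subseteq> {i, j, k}"
    by (rule ess_vars_subset) (simp add: depends_only_on_def F)
  ultimately have E: "ess_vars F = {i, j, k}" by blast
  have ab: "absorbs F i j k"
    unfolding absorbs_def by (auto simp: F)
  have ij: "lossy F i j"
    using ab E by (auto simp: lossy_def)
  have ikjk: "lossy F i k \<and> lossy F j k"
  proof (cases "e = 0")
    case zero: True
    have "absorbs F i k j" "absorbs F j k i"
      unfolding absorbs_def by (auto simp: F zero)
    then show ?thesis unfolding lossy_def E by blast
  next
    case False
    then have one: "e = 1" by simp
    have "cancels F i k" "cancels F j k"
      unfolding cancels_def by (auto simp: F one add.assoc)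
    then show ?thesis unfolding lossy_def by blast
  qed
  show "\<forall>a\<in>ess_vars F. \<forall>b\<in>ess_vars F. a \<noteq> b \<longrightarrow> lossy F a b"
    using ij ikjk lossy_commute[of F] by (auto simp: E)
  have "\<not> cancels F i j"
    unfolding cancels_def by (auto simp: F intro!: exI[of _ "\<lambda>_. 0"])
  then have "j \<in> ess_vars (identify i j F)"
    using ess_vars_identify_iff(2) d(1) by blast
  moreover have "finite (ess_vars (identify i j F))"
    by (rule finite_subset[OF ess_vars_identify_subset]) (auto simp: E)
  ultimately have "1 \<le> card (ess_vars (identify i j F))"
    by (metis One_nat_def Suc_leI card_gt_0_iff empty_iff)
  moreover have "card (ess_vars F) = 3" by (simp add: E)
  ultimately show "\<exists>a\<in>ess_vars F. \<exists>b\<in>ess_vars F. a \<noteq> b \<and> card (ess_vars F) \<le> card (ess_vars (identify a b F)) + 2"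
    by (intro bexI[of _ i] bexI[of _ j]) (auto simp: E)
qed

lemma special_fun_identifications:
  assumes "special_fun V F" "finite V" "2 \<le> card (ess_vars F)"
  shows "\<forall>a\<in>ess_vars F. \<forall>b\<in>ess_vars F. a \<noteq> b \<longrightarrow> lossy F a b"
    and "\<exists>a\<in>ess_vars F. \<exists>b\<in>ess_vars F. a \<noteq> b \<and> card (ess_vars F) \<le> card (ess_vars (identify a b F)) + 2"
proof -
  note parity = parity_identifications[OF finite_subset[OF _ assms(2)] _ assms(3)]
  note quadratic = quadratic_identifications[OF _ _ assms(3)]
  from assms(1) have "(\<forall>a\<in>ess_vars F. \<forall>b\<in>ess_vars F. a \<noteq> b \<longrightarrow> lossy F a b) \<and>
    (\<exists>a\<in>ess_vars F. \<exists>b\<in>ess_vars F. a \<noteq> b \<and> card (ess_vars F) \<le> card (ess_vars (identify a b F)) + 2)"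
    (is "?lossy \<and> ?big")
    unfolding special_fun_def
  proof (elim disjE exE bexE conjE)
    fix c I assume "I \<subseteq> V" "\<forall>x. F x = (\<Sum>i\<in>I. x i) + c"
    then show ?thesis using parity[of I c] by auto
  next
    fix c i j assume "i \<noteq> j" "\<forall>x. F x = x i * x j + x i + c"
    then show ?thesis using quadratic[of i j c] by auto
  next
    fix c i j k e assume "i \<noteq> j" "i \<noteq> k" "j \<noteq> k" "\<forall>x. F x = maj (x i) (x j) (x k + e) + c"
    then show ?thesis using maj_identifications[of i j k F e c] by auto
  qed
  then show ?lossy ?big by auto
qed

section \<open>Minors and the arity gap\<close>

text \<open>
  The bridge from functions on a cube to the functions on all assignments treated so far.
\<close>

definition extension :: "nat \<Rightarrow> ((nat \<Rightarrow> bit) \<Rightarrow> bit) \<Rightarrow> (nat \<Rightarrow> bit) \<Rightarrow> bit" where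
  "extension n f x = f (restrict x {1..n})"

lemma restrict_in_cube: "restrict x {1..n} \<in> cube n"
  by (simp add: cube_def)

lemma extension_cube: "a \<in> cube n \<Longrightarrow> extension n f a = f a"
  by (simp add: extension_def cube_def PiE_restrict)

lemma depends_only_on_extension: "depends_only_on (extension n f) {1..n}"
  unfolding depends_only_on_def extension_def by (metis restrict_ext)

lemma essential_iff: "essential n f i \<longleftrightarrow> i \<in> ess_vars (extension n f)"
proof
  assume "essential n f i"
  then obtain a b where ab: "i \<in> {1..n}" "a \<in> cube n" "f a \<noteq> f (a(i := b))"
    by (auto simp: essential_def)
  then have "a(i := b) \<in> cube n"
    by (auto simp: cube_def PiE_def extensional_def)
  with ab have "extension n f (a(i := b)) \<noteq> extension n f a"
    by (simp add: extension_cube)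
  then show "i \<in> ess_vars (extension n f)"
    using inessential_upd by blast
next
  assume i: "i \<in> ess_vars (extension n f)"
  then have in': "i \<in> {1..n}"
    using ess_vars_subset[OF depends_only_on_extension] by blast
  from i obtain x where x: "extension n f (flip i x) \<noteq> extension n f x"
    by (auto simp: ess_vars_def)
  have "restrict (flip i x) {1..n} = (restrict x {1..n})(i := x i + 1)"
    using in' by (auto simp: flip_def restrict_def)
  with x have "f (restrict x {1..n}) \<noteq> f ((restrict x {1..n})(i := x i + 1))"
    by (simp add: extension_def)
  with in' restrict_in_cube[of x n] show "essential n f i"
    unfolding essential_def by blast
qed

lemma ess_eq_card: "ess n f = card (ess_vars (extension n f))"
  by (simp add: ess_def essential_iff)

lemma ess_vars_extension_subset: "ess_vars (extension n f) \<subseteq> {1..n}"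
  by (rule ess_vars_subset[OF depends_only_on_extension])

lemma finite_ess_vars_extension: "finite (ess_vars (extension n f))"
  using ess_vars_extension_subset by (rule finite_subset) simp

lemma depends_only_on_ess_vars_extension: "depends_only_on (extension n f) (ess_vars (extension n f))"
  by (rule depends_only_on_ess_vars[OF _ depends_only_on_extension]) simp

lemma subst_le_iff:
  "subst_le m g n f \<longleftrightarrow> (\<exists>\<sigma> \<in> {1..n} \<rightarrow> {1..m}. \<forall>x. extension m g x = extension n f (x \<circ> \<sigma>))"
proof -
  have "(\<forall>x\<in>cube m. g x = f (\<lambda>k\<in>{1..n}. x (\<sigma> k))) \<longleftrightarrow> (\<forall>x. extension m g x = extension n f (x \<circ> \<sigma>))"
    if \<sigma>: "\<sigma> \<in> {1..n} \<rightarrow> {1..m}" for \<sigma>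
  proof
    assume *: "\<forall>x\<in>cube m. g x = f (\<lambda>k\<in>{1..n}. x (\<sigma> k))"
    show "\<forall>x. extension m g x = extension n f (x \<circ> \<sigma>)"
    proof
      fix x :: "nat \<Rightarrow> bit"
      have "(\<lambda>k\<in>{1..n}. (restrict x {1..m}) (\<sigma> k)) = restrict (x \<circ> \<sigma>) {1..n}"
        using \<sigma> by (intro restrict_ext) (auto simp: Pi_iff)
      with * restrict_in_cube show "extension m g x = extension n f (x \<circ> \<sigma>)"
        by (simp add: extension_def)
    qed
  next
    assume *: "\<forall>x. extension m g x = extension n f (x \<circ> \<sigma>)"
    show "\<forall>x\<in>cube m. g x = f (\<lambda>k\<in>{1..n}. x (\<sigma> k))"
    proof
      fix x assume x: "x \<in> cube m"
      have "restrict (x \<circ> \<sigma>) {1..n} = (\<lambda>k\<in>{1..n}. x (\<sigma> k))"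
        by (intro restrict_ext) simp
      with * x show "g x = f (\<lambda>k\<in>{1..n}. x (\<sigma> k))"
        by (metis extension_cube extension_def)
    qed
  qed
  then show ?thesis
    unfolding subst_le_def by (rule bex_cong[OF refl])
qed

lemma ess_vars_substitution:
  assumes dep: "depends_only_on F (ess_vars F)" and G: "\<And>x. G x = F (x \<circ> \<sigma>)"
  shows "ess_vars G \<subseteq> \<sigma> ` ess_vars F"
proof (rule ess_vars_subset)
  show "depends_only_on G (\<sigma> ` ess_vars F)"
    unfolding depends_only_on_def G
    by (auto intro!: depends_only_onD[OF dep])
qed

lemma ess_mono:
  assumes "subst_le m g n f"
  shows "ess m g \<le> ess n f"
proof -
  from assms obtain \<sigma> where "\<And>x. extension m g x = extension n f (x \<circ> \<sigma>)"
    unfolding subst_le_iff by blast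
  from ess_vars_substitution[OF depends_only_on_ess_vars_extension this]
  show ?thesis
    unfolding ess_eq_card using surj_card_le finite_ess_vars_extension by blast
qed

text \<open>
  If no two essential variables are merged, the substitution can be undone: send the image of an
  essential variable back to it and all other variables anywhere, say to \<open>1\<close>.
\<close>

lemma inj_substitution_reversible:
  assumes n: "0 < n" and \<sigma>: "\<sigma> \<in> {1..n} \<rightarrow> {1..m}" "inj_on \<sigma> (ess_vars (extension n f))"
    and g: "\<And>x. extension m g x = extension n f (x \<circ> \<sigma>)"
  shows "subst_le n f m g"
proof -
  let ?E = "ess_vars (extension n f)"
  define \<tau> where "\<tau> = (\<lambda>l. if l \<in> \<sigma> ` ?E then inv_into ?E \<sigma> l else 1)"
  have "\<tau> \<in> {1..m} \<rightarrow> {1..n}"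
  proof
    fix l
    show "\<tau> l \<in> {1..n}"
      using inv_into_into[of l \<sigma> ?E] ess_vars_extension_subset[of n f] n by (auto simp: \<tau>_def)
  qed
  moreover have "extension n f y = extension m g (y \<circ> \<tau>)" for y
    unfolding g using \<sigma>(2)
    by (intro depends_only_onD[OF depends_only_on_ess_vars_extension]) (simp add: \<tau>_def)
  ultimately show ?thesis
    unfolding subst_le_iff by blast
qed

text \<open>
  A strict minor merges some two essential variables \<open>i\<close> and \<open>j\<close>, so it is also a minor of the
  identification minor for \<open>i\<close> and \<open>j\<close>, and minors do not gain essential variables.
\<close>

lemma ess_strict_minor_le_identify:
  assumes n: "0 < n" and less: "subst_less m g n f"
  shows "\<exists>i\<in>ess_vars (extension n f). \<exists>j\<in>ess_vars (extension n f).
    i \<noteq> j \<and> ess m g \<le> card (ess_vars (identify i j (extension n f)))"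
proof -
  let ?F = "extension n f"
  from less obtain \<sigma> where \<sigma>: "\<sigma> \<in> {1..n} \<rightarrow> {1..m}"
    and g: "\<And>x. extension m g x = ?F (x \<circ> \<sigma>)"
    unfolding subst_less_def subst_le_iff[of m g] by blast
  have "\<not> inj_on \<sigma> (ess_vars ?F)"
    using inj_substitution_reversible[OF n \<sigma> _ g] less unfolding subst_less_def by blast
  then obtain i j where ij: "i \<in> ess_vars ?F" "j \<in> ess_vars ?F" "i \<noteq> j" "\<sigma> i = \<sigma> j"
    unfolding inj_on_def by blast
  let ?H = "identify i j ?F"
  have fin: "finite (ess_vars ?H)"
    using finite_subset[OF ess_vars_identify_subset[OF ij(3,2)]] finite_ess_vars_extension by blast
  have "depends_only_on ?H {1..n}"
    unfolding depends_only_on_def identify_def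
    using ij ess_vars_extension_subset[of n f] by (auto intro!: depends_only_onD[OF depends_only_on_extension])
  then have dep: "depends_only_on ?H (ess_vars ?H)"
    by (rule depends_only_on_ess_vars[rotated]) simp
  have "extension m g x = ?H (x \<circ> \<sigma>)" for x
  proof -
    have "(x \<circ> \<sigma>)(i := (x \<circ> \<sigma>) j) = x \<circ> \<sigma>"
      using ij(4) by (simp add: fun_upd_idem)
    then show ?thesis by (simp add: g identify_def)
  qed
  from ess_vars_substitution[OF dep this] have "ess m g \<le> card (ess_vars ?H)"
    unfolding ess_eq_card using surj_card_le fin by blast
  with ij show ?thesis by blast
qed

lemma identify_strict_minor:
  assumes ij: "i \<in> ess_vars (extension n f)" "j \<in> ess_vars (extension n f)" "i \<noteq> j"
  shows "\<exists>g. subst_less n g n f \<and> ess n g = card (ess_vars (identify i j (extension n f)))"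
proof -
  define g where "g = (\<lambda>x. f (x(i := x j)))"
  have ijn: "i \<in> {1..n}" "j \<in> {1..n}"
    using ij ess_vars_extension_subset[of n f] by blast+
  have tg: "extension n g = identify i j (extension n f)"
  proof
    fix x :: "nat \<Rightarrow> bit"
    have "(restrict x {1..n})(i := restrict x {1..n} j) = restrict (x(i := x j)) {1..n}"
      using ijn by (auto simp: restrict_def)
    then show "extension n g x = identify i j (extension n f) x"
      by (simp add: extension_def g_def identify_def)
  qed
  have "id(i := j) \<in> {1..n} \<rightarrow> {1..n}"
    using ijn by auto
  moreover have "extension n g x = extension n f (x \<circ> id(i := j))" for x
  proof -
    have "x \<circ> id(i := j) = x(i := x j)" by (auto simp: fun_eq_iff)
    then show ?thesis by (simp add: tg identify_def)
  qed
  ultimately have "subst_le n g n f"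
    unfolding subst_le_iff by blast
  moreover have "\<not> subst_le n f n g"
    using ess_mono[of n f n g] card_ess_vars_identify(1)[OF finite_ess_vars_extension ij]
    by (auto simp: ess_eq_card tg)
  ultimately show ?thesis
    unfolding subst_less_def ess_eq_card tg[symmetric] by blast
qed

text \<open>
  Together: the maximum over all strict minors, of whatever arity, is the maximum over the
  identification minors.
\<close>

lemma ess_less_properties:
  assumes n: "0 < n" and two: "2 \<le> ess n f"
  shows "\<And>i j. i \<in> ess_vars (extension n f) \<Longrightarrow> j \<in> ess_vars (extension n f) \<Longrightarrow> i \<noteq> j \<Longrightarrow>
      card (ess_vars (identify i j (extension n f))) \<le> ess_less n f"
    and "\<exists>i\<in>ess_vars (extension n f). \<exists>j\<in>ess_vars (extension n f).
      i \<noteq> j \<and> ess_less n f \<le> card (ess_vars (identify i j (extension n f)))"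
proof -
  let ?A = "{ess m g | m g. 0 < m \<and> subst_less m g n f}"
  have "?A \<subseteq> {..ess n f}"
    using ess_mono by (auto simp: subst_less_def)
  then have fin: "finite ?A"
    by (rule finite_subset) simp
  have inA: "card (ess_vars (identify i j (extension n f))) \<in> ?A"
    if "i \<in> ess_vars (extension n f)" "j \<in> ess_vars (extension n f)" "i \<noteq> j" for i j
    using identify_strict_minor[OF that] n by (metis (mono_tags, lifting) mem_Collect_eq)
  with fin show "\<And>i j. i \<in> ess_vars (extension n f) \<Longrightarrow> j \<in> ess_vars (extension n f) \<Longrightarrow> i \<noteq> j \<Longrightarrow>
      card (ess_vars (identify i j (extension n f))) \<le> ess_less n f"
    unfolding ess_less_def by (intro Max_ge)
  from two obtain a b where "a \<in> ess_vars (extension n f)" "b \<in> ess_vars (extension n f)" "a \<noteq> b"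
    unfolding ess_eq_card numeral_2_eq_2 card_le_Suc_iff by auto
  with inA have "?A \<noteq> {}" by blast
  with fin have "ess_less n f \<in> ?A"
    unfolding ess_less_def by (rule Max_in)
  then obtain m g where "ess_less n f = ess m g" "subst_less m g n f" by blast
  with ess_strict_minor_le_identify[OF n] show "\<exists>i\<in>ess_vars (extension n f). \<exists>j\<in>ess_vars (extension n f).
      i \<noteq> j \<and> ess_less n f \<le> card (ess_vars (identify i j (extension n f)))"
    by metis
qed

theorem gap_classification:
  assumes n: "0 < n" and two: "2 \<le> ess n f"
  shows "gap n f = (if special_fun {1..n} (extension n f) then 2 else 1)"
proof -
  let ?F = "extension n f"
  note fin = finite_ess_vars_extension[of n f] and dep = depends_only_on_ess_vars_extension[of n f]
  have two': "2 \<le> card (ess_vars ?F)"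
    using two by (simp add: ess_eq_card)
  obtain p q where pq: "p \<in> ess_vars ?F" "q \<in> ess_vars ?F" "p \<noteq> q"
      "ess_less n f \<le> card (ess_vars (identify p q ?F))"
    using ess_less_properties(2)[OF n two] by blast
  show ?thesis
  proof (cases "special_fun {1..n} ?F")
    case True
    note sp = special_fun_identifications[OF True _ two', simplified]
    obtain a b where "a \<in> ess_vars ?F" "b \<in> ess_vars ?F" "a \<noteq> b"
      "card (ess_vars ?F) \<le> card (ess_vars (identify a b ?F)) + 2"
      using sp(2) by auto
    with ess_less_properties(1)[OF n two] have "card (ess_vars ?F) \<le> ess_less n f + 2"
      by fastforce
    moreover have "lossy ?F p q" using sp(1) pq by blast
    then have "ess_less n f + 2 \<le> card (ess_vars ?F)"
      using card_ess_vars_identify(2)[OF fin pq(1-3)] pq(4) by linarith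
    ultimately show ?thesis
      using True by (simp add: gap_def ess_eq_card)
  next
    case False
    then obtain a b where ab: "a \<in> ess_vars ?F" "b \<in> ess_vars ?F" "a \<noteq> b" "\<not> lossy ?F a b"
      using all_lossy_imp_special[OF fin dep two'] special_fun_mono ess_vars_extension_subset by blast
    then have "card (ess_vars ?F) \<le> card (ess_vars (identify a b ?F)) + 1"
      using card_ess_vars_identify(2)[OF fin ab(1-3)] by linarith
    with ess_less_properties(1)[OF n two ab(1-3)] have "card (ess_vars ?F) \<le> ess_less n f + 1"
      by linarith
    moreover have "ess_less n f < card (ess_vars ?F)"
      using card_ess_vars_identify(1)[OF fin pq(1-3)] pq(4) by linarith
    ultimately show ?thesis
      using False by (simp add: gap_def ess_eq_card)
  qed
qed

section \<open>Zhegalkin polynomials\<close>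

abbreviation eval_monomial :: "(nat \<Rightarrow>\<^sub>0 nat) \<Rightarrow> (nat \<Rightarrow> bit) \<Rightarrow> bit" where
  "eval_monomial m a \<equiv> \<Prod>i\<in>Poly_Mapping.keys m. a i ^ Poly_Mapping.lookup m i"

lemma eval_mpoly_superset:
  assumes "finite K" "Poly_Mapping.keys p \<subseteq> K"
  shows "eval_mpoly p a = (\<Sum>m\<in>K. Poly_Mapping.lookup p m * eval_monomial m a)"
  unfolding eval_mpoly_def
  using assms by (intro sum.mono_neutral_left) (auto simp: in_keys_iff)

lemma eval_mpoly_add: "eval_mpoly (p + q) a = eval_mpoly p a + eval_mpoly q a"
proof -
  let ?K = "Poly_Mapping.keys p \<union> Poly_Mapping.keys q"
  have "eval_mpoly r a = (\<Sum>m\<in>?K. Poly_Mapping.lookup r m * eval_monomial m a)"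
    if "Poly_Mapping.keys r \<subseteq> ?K" for r
    using that by (intro eval_mpoly_superset) auto
  then show ?thesis
    by (simp add: Poly_Mapping.keys_add lookup_add distrib_right sum.distrib)
qed

lemma eval_mpoly_single: "eval_mpoly (Poly_Mapping.single m c) a = c * eval_monomial m a"
  by (simp add: eval_mpoly_def)

lemma eval_mpoly_zero [simp]: "eval_mpoly 0 a = 0"
  by (simp add: eval_mpoly_def)

lemma eval_mpoly_sum: "eval_mpoly (\<Sum>i\<in>I. p i) a = (\<Sum>i\<in>I. eval_mpoly (p i) a)"
  by (induction I rule: infinite_finite_induct) (simp_all add: eval_mpoly_add)

lemma multilinear_add: "multilinear n p \<Longrightarrow> multilinear n q \<Longrightarrow> multilinear n (p + q)"
  unfolding multilinear_def using Poly_Mapping.keys_add[of p q] by blast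

lemma multilinear_sum: "(\<And>i. i \<in> I \<Longrightarrow> multilinear n (p i)) \<Longrightarrow> multilinear n (\<Sum>i\<in>I. p i)"
  by (induction I rule: infinite_finite_induct) (auto simp: multilinear_add, simp_all add: multilinear_def)

definition squarefree_exponent :: "nat set \<Rightarrow> nat \<Rightarrow>\<^sub>0 nat" where
  "squarefree_exponent S = (\<Sum>i\<in>S. Poly_Mapping.single i 1)"

lemma lookup_squarefree_exponent:
  "finite S \<Longrightarrow> Poly_Mapping.lookup (squarefree_exponent S) i = of_bool (i \<in> S)"
  unfolding squarefree_exponent_def
  by (induction S rule: finite_induct) (auto simp: lookup_add lookup_single when_def)

lemma keys_squarefree_exponent [simp]: "finite S \<Longrightarrow> Poly_Mapping.keys (squarefree_exponent S) = S"
  by (auto simp: in_keys_iff lookup_squarefree_exponent)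

lemma multilinear_single:
  "S \<subseteq> {1..n} \<Longrightarrow> multilinear n (Poly_Mapping.single (squarefree_exponent S) c)"
  using finite_subset[of S "{1..n}"]
  by (auto simp: multilinear_def lookup_squarefree_exponent)

lemma eval_squarefree:
  "finite S \<Longrightarrow> eval_mpoly (Poly_Mapping.single (squarefree_exponent S) c) a = c * (\<Prod>i\<in>S. a i)"
  by (simp add: eval_mpoly_single lookup_squarefree_exponent cong: prod.cong)

text \<open>
  Induction over the variables by the Shannon expansion
  \<open>F x = F (x(v := 0)) + x v * (F (x(v := 0)) + F (x(v := 1)))\<close>.
\<close>

lemma exists_multilinear_coefficients:
  assumes "finite V" "depends_only_on F V"
  shows "\<exists>c. \<forall>x. F x = (\<Sum>S\<in>Pow V. c S * (\<Prod>i\<in>S. x i))"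
  using assms
proof (induction V arbitrary: F rule: finite_induct)
  case empty
  then show ?case
    using depends_only_on_empty[of F] by (auto intro!: exI[of _ "\<lambda>_. F (\<lambda>_. 0)"])
next
  case (insert v V)
  define F0 where "F0 = (\<lambda>x. F (x(v := 0)))"
  define F1 where "F1 = (\<lambda>x. F (x(v := 0)) + F (x(v := 1)))"
  have dep: "F (x(v := b)) = F (y(v := b))" if "\<forall>i\<in>V. x i = y i" for x y b
    using that by (intro depends_only_onD[OF insert.prems]) auto
  have "depends_only_on F0 V" "depends_only_on F1 V"
    unfolding depends_only_on_def F0_def F1_def using dep by (metis (no_types, lifting))+
  then obtain c0 c1 where c0: "\<And>x. F0 x = (\<Sum>S\<in>Pow V. c0 S * (\<Prod>i\<in>S. x i))"
      and c1: "\<And>x. F1 x = (\<Sum>S\<in>Pow V. c1 S * (\<Prod>i\<in>S. x i))"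
    using insert.IH by metis
  define c where "c = (\<lambda>S. if v \<in> S then c1 (S - {v}) else c0 S)"
  have "F x = (\<Sum>S\<in>Pow (insert v V). c S * (\<Prod>i\<in>S. x i))" for x
  proof -
    have inj: "inj_on (insert v) (Pow V)"
      using insert.hyps by (intro inj_onI) (metis Diff_insert_absorb PowD subsetD)
    have "(\<Sum>S\<in>Pow (insert v V). c S * (\<Prod>i\<in>S. x i)) =
        (\<Sum>S\<in>Pow V. c S * (\<Prod>i\<in>S. x i)) + (\<Sum>S\<in>insert v ` Pow V. c S * (\<Prod>i\<in>S. x i))"
      unfolding Pow_insert using insert.hyps by (intro sum.union_disjoint) auto
    also have "(\<Sum>S\<in>insert v ` Pow V. c S * (\<Prod>i\<in>S. x i)) =
        (\<Sum>S\<in>Pow V. c (insert v S) * (\<Prod>i\<in>insert v S. x i))"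
      by (simp add: sum.reindex[OF inj])
    also have "\<dots> = (\<Sum>S\<in>Pow V. x v * (c1 S * (\<Prod>i\<in>S. x i)))"
    proof (rule sum.cong[OF refl])
      fix S assume "S \<in> Pow V"
      then have "v \<notin> S" "finite S"
        using insert.hyps finite_subset by auto
      then show "c (insert v S) * (\<Prod>i\<in>insert v S. x i) = x v * (c1 S * (\<Prod>i\<in>S. x i))"
        by (simp add: c_def ac_simps)
    qed
    also have "\<dots> = x v * F1 x"
      by (simp add: c1 sum_distrib_left)
    also have "(\<Sum>S\<in>Pow V. c S * (\<Prod>i\<in>S. x i)) = F0 x"
      unfolding c0 using insert.hyps by (intro sum.cong) (auto simp: c_def)
    also have "F0 x + x v * F1 x = F (x(v := x v))"
      by (cases "x v") (simp_all only: F0_def F1_def mult_zero_left mult_1_left bit_add_self_left add_0_right)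
    finally show ?thesis by simp
  qed
  then show ?case by blast
qed

lemma exists_zhegalkin: "\<exists>p. multilinear n p \<and> (\<forall>a\<in>cube n. eval_mpoly p a = f a)"
proof -
  obtain c where c: "\<And>x. extension n f x = (\<Sum>S\<in>Pow {1..n}. c S * (\<Prod>i\<in>S. x i))"
    using exists_multilinear_coefficients[OF _ depends_only_on_extension] by blast
  let ?p = "\<Sum>S\<in>Pow {1..n}. Poly_Mapping.single (squarefree_exponent S) (c S)"
  have "eval_mpoly ?p x = extension n f x" for x
    unfolding c eval_mpoly_sum
    by (intro sum.cong refl eval_squarefree) (auto intro: finite_subset)
  moreover have "multilinear n ?p"
    by (intro multilinear_sum multilinear_single) auto
  ultimately show ?thesis
    by (intro exI[of _ ?p]) (simp add: extension_cube)
qed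

text \<open>
  At the indicator assignment of a monomial with the fewest variables, this monomial is \<open>1\<close> and all the
  others vanish, so its coefficient would be the value of the polynomial.
\<close>

lemma multilinear_eq_zero:
  assumes "multilinear n p" "\<And>a. a \<in> cube n \<Longrightarrow> eval_mpoly p a = 0"
  shows "p = 0"
proof (rule ccontr)
  assume "p \<noteq> 0"
  then have "\<exists>m. m \<in> Poly_Mapping.keys p"
    by (metis keys_eq_empty ex_in_conv)
  then obtain m where m: "m \<in> Poly_Mapping.keys p"
    and min: "\<And>m'. m' \<in> Poly_Mapping.keys p \<Longrightarrow> card (Poly_Mapping.keys m) \<le> card (Poly_Mapping.keys m')"
    using arg_min_nat_lemma[of "\<lambda>m. m \<in> Poly_Mapping.keys p" _ "\<lambda>m. card (Poly_Mapping.keys m)"]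
    by blast
  define a :: "nat \<Rightarrow> bit" where "a = (\<lambda>i\<in>{1..n}. of_bool (i \<in> Poly_Mapping.keys m))"
  have a: "a \<in> cube n" by (simp add: a_def cube_def)
  have ml: "Poly_Mapping.keys m' \<subseteq> {1..n}" "Poly_Mapping.lookup m' i \<le> 1"
    if "m' \<in> Poly_Mapping.keys p" for m' i
    using assms(1) that by (auto simp: multilinear_def)
  have "eval_monomial m' a = of_bool (m' = m)" if m': "m' \<in> Poly_Mapping.keys p" for m'
  proof (cases "Poly_Mapping.keys m' \<subseteq> Poly_Mapping.keys m")
    case True
    then have keys: "Poly_Mapping.keys m' = Poly_Mapping.keys m"
      using min[OF m'] by (intro card_seteq) auto
    have "Poly_Mapping.lookup m' i = Poly_Mapping.lookup m i" for i
    proof (cases "i \<in> Poly_Mapping.keys m")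
      case True
      then have "Poly_Mapping.lookup m' i \<noteq> 0" "Poly_Mapping.lookup m i \<noteq> 0"
        using keys by (metis in_keys_iff)+
      then show ?thesis
        using ml(2)[OF m', of i] ml(2)[OF m, of i] by linarith
    next
      case False
      then show ?thesis using keys by (metis in_keys_iff)
    qed
    then have "m' = m" by (rule poly_mapping_eqI)
    moreover have "eval_monomial m a = 1"
      using ml(1)[OF m] by (intro prod.neutral) (auto simp: a_def)
    ultimately show ?thesis by simp
  next
    case False
    then obtain i where i: "i \<in> Poly_Mapping.keys m'" "i \<notin> Poly_Mapping.keys m" by blast
    moreover have "i \<in> {1..n}"
      using ml(1)[OF m'] i(1) by blast
    ultimately have "a i ^ Poly_Mapping.lookup m' i = 0"
      by (simp add: a_def in_keys_iff)
    with i show ?thesis by (intro prod_zero[THEN trans]) auto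
  qed
  then have "eval_mpoly p a = (\<Sum>m'\<in>Poly_Mapping.keys p. if m' = m then Poly_Mapping.lookup p m' else 0)"
    unfolding eval_mpoly_def by (intro sum.cong) auto
  also have "\<dots> = Poly_Mapping.lookup p m"
    using m by simp
  finally show False
    using assms(2)[OF a] m by (simp add: in_keys_iff)
qed

lemma multilinear_unique:
  assumes "multilinear n p" "multilinear n q" "\<And>a. a \<in> cube n \<Longrightarrow> eval_mpoly p a = eval_mpoly q a"
  shows "p = q"
proof -
  \<comment> \<open>In characteristic two the sum is the difference.\<close>
  have "p + q = 0"
    using assms by (intro multilinear_eq_zero[of n] multilinear_add) (auto simp: eval_mpoly_add)
  then have "Poly_Mapping.lookup p m + Poly_Mapping.lookup q m = 0" for m
    by (metis lookup_add lookup_zero)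
  then have "Poly_Mapping.lookup p m = Poly_Mapping.lookup q m" for m
    by (metis bit_add_self_left add_0_right)
  then show ?thesis by (rule poly_mapping_eqI)
qed

lemma eval_mpoly_restrict:
  assumes "multilinear n p"
  shows "eval_mpoly p (restrict x {1..n}) = eval_mpoly p x"
proof -
  have "eval_monomial m (restrict x {1..n}) = eval_monomial m x" if "m \<in> Poly_Mapping.keys p" for m
  proof (rule prod.cong[OF refl])
    fix i assume "i \<in> Poly_Mapping.keys m"
    with assms that have "i \<in> {1..n}" unfolding multilinear_def by blast
    then show "restrict x {1..n} i ^ Poly_Mapping.lookup m i = x i ^ Poly_Mapping.lookup m i"
      by simp
  qed
  then show ?thesis
    unfolding eval_mpoly_def by (intro sum.cong) auto
qed

text \<open>
  Existence and uniqueness of the Zhegalkin polynomial resolve the definite description.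
\<close>

lemma zhegalkin_eq_iff:
  "zhegalkin n f = p \<longleftrightarrow> multilinear n p \<and> (\<forall>x. eval_mpoly p x = extension n f x)"
proof -
  define spec where "spec = (\<lambda>p. multilinear n p \<and> (\<forall>a\<in>cube n. eval_mpoly p a = f a))"
  have "\<exists>!p. spec p"
  proof (rule ex_ex1I)
    show "\<exists>p. spec p"
      unfolding spec_def by (rule exists_zhegalkin)
    show "p = q" if "spec p" "spec q" for p q
      using that by (intro multilinear_unique[of n]) (simp_all add: spec_def)
  qed
  then have "(THE p. spec p) = p \<longleftrightarrow> spec p"
    using the1_equality[of spec p] theI'[of spec] by auto
  moreover have "(\<forall>a\<in>cube n. eval_mpoly p a = f a) \<longleftrightarrow> (\<forall>x. eval_mpoly p x = extension n f x)"
    if p: "multilinear n p"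
  proof
    assume *: "\<forall>a\<in>cube n. eval_mpoly p a = f a"
    show "\<forall>x. eval_mpoly p x = extension n f x"
      using * restrict_in_cube eval_mpoly_restrict[OF p] by (simp add: extension_def)
  next
    assume "\<forall>x. eval_mpoly p x = extension n f x"
    then show "\<forall>a\<in>cube n. eval_mpoly p a = f a"
      by (simp add: extension_cube)
  qed
  ultimately show ?thesis
    unfolding zhegalkin_def spec_def by blast
qed

lemma X_single: "X i = Poly_Mapping.single (squarefree_exponent {i}) 1"
  and C_single: "C c = Poly_Mapping.single (squarefree_exponent {}) c"
  and X_mult_X: "i \<noteq> j \<Longrightarrow> X i * X j = Poly_Mapping.single (squarefree_exponent {i, j}) 1"
  by (simp_all add: X_def C_def squarefree_exponent_def mult_single)

lemma multilinear_X: "i \<in> {1..n} \<Longrightarrow> multilinear n (X i)"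
  and multilinear_C: "multilinear n (C c)"
  and multilinear_X_mult_X: "i \<in> {1..n} \<Longrightarrow> j \<in> {1..n} \<Longrightarrow> i \<noteq> j \<Longrightarrow> multilinear n (X i * X j)"
  unfolding X_single C_single
  by (auto intro!: multilinear_single simp: X_mult_X[unfolded X_single])

lemma eval_X: "eval_mpoly (X i) x = x i"
  and eval_C: "eval_mpoly (C c) x = c"
  and eval_X_mult_X: "i \<noteq> j \<Longrightarrow> eval_mpoly (X i * X j) x = x i * x j"
  by (simp_all add: X_single C_single eval_squarefree X_mult_X[unfolded X_single])

lemmas multilinear_intros = multilinear_add multilinear_sum multilinear_X multilinear_C multilinear_X_mult_X
lemmas eval_simps = eval_mpoly_add eval_mpoly_sum eval_X eval_C eval_X_mult_X

lemma special_form_zhegalkin_iff: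
  "special_form n (zhegalkin n f) \<longleftrightarrow> special_fun {1..n} (extension n f)"
proof -
  let ?F = "extension n f" and ?z = "zhegalkin n f"
  have parity: "?z = (\<Sum>i\<in>I. X i) + C c \<longleftrightarrow> (\<forall>x. ?F x = (\<Sum>i\<in>I. x i) + c)" if "I \<subseteq> {1..n}" for I c
  proof -
    have "multilinear n ((\<Sum>i\<in>I. X i) + C c)"
      using that by (intro multilinear_intros) auto
    then show ?thesis by (auto simp: zhegalkin_eq_iff eval_simps)
  qed
  have quadratic: "?z = X i * X j + X i + C c \<longleftrightarrow> (\<forall>x. ?F x = x i * x j + x i + c)"
    if "i \<in> {1..n}" "j \<in> {1..n}" "i \<noteq> j" for i j c
  proof -
    have "multilinear n (X i * X j + X i + C c)"
      using that by (intro multilinear_intros)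
    with that show ?thesis by (auto simp: zhegalkin_eq_iff eval_simps)
  qed
  have maj0: "?z = X i * X j + X i * X k + X j * X k + C c \<longleftrightarrow>
      (\<forall>x. ?F x = maj (x i) (x j) (x k + 0) + c)"
    if "i \<in> {1..n}" "j \<in> {1..n}" "k \<in> {1..n}" "i \<noteq> j" "i \<noteq> k" "j \<noteq> k" for i j k c
  proof -
    have "multilinear n (X i * X j + X i * X k + X j * X k + C c)"
      using that by (intro multilinear_intros)
    with that show ?thesis by (auto simp: zhegalkin_eq_iff eval_simps maj_def)
  qed
  have maj1: "?z = X i * X j + X i * X k + X j * X k + X i + X j + C c \<longleftrightarrow>
      (\<forall>x. ?F x = maj (x i) (x j) (x k + 1) + c)"
    if "i \<in> {1..n}" "j \<in> {1..n}" "k \<in> {1..n}" "i \<noteq> j" "i \<noteq> k" "j \<noteq> k" for i j k c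
  proof -
    have "multilinear n (X i * X j + X i * X k + X j * X k + X i + X j + C c)"
      using that by (intro multilinear_intros)
    with that show ?thesis by (auto simp: zhegalkin_eq_iff eval_simps maj_def algebra_simps)
  qed
  let ?V = "{1..n}"
  have 1: "(\<exists>I. I \<noteq> {} \<and> I \<subseteq> ?V \<and> ?z = (\<Sum>i\<in>I. X i) + C c) \<longleftrightarrow>
      (\<exists>I. I \<noteq> {} \<and> I \<subseteq> ?V \<and> (\<forall>x. ?F x = (\<Sum>i\<in>I. x i) + c))" for c
    by (intro ex_cong1 conj_cong refl parity)
  have 2: "(\<exists>i\<in>?V. \<exists>j\<in>?V. i \<noteq> j \<and> ?z = X i * X j + X i + C c) \<longleftrightarrow>
      (\<exists>i\<in>?V. \<exists>j\<in>?V. i \<noteq> j \<and> (\<forall>x. ?F x = x i * x j + x i + c))" for c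
    by (intro bex_cong conj_cong refl quadratic)
  have 3: "(\<exists>i\<in>?V. \<exists>j\<in>?V. \<exists>k\<in>?V. i \<noteq> j \<and> i \<noteq> k \<and> j \<noteq> k \<and>
        ?z = X i * X j + X i * X k + X j * X k + C c) \<longleftrightarrow>
      (\<exists>i\<in>?V. \<exists>j\<in>?V. \<exists>k\<in>?V. i \<noteq> j \<and> i \<noteq> k \<and> j \<noteq> k \<and>
        (\<forall>x. ?F x = maj (x i) (x j) (x k + 0) + c))" for c
    by (intro bex_cong conj_cong refl maj0)
  have 4: "(\<exists>i\<in>?V. \<exists>j\<in>?V. \<exists>k\<in>?V. i \<noteq> j \<and> i \<noteq> k \<and> j \<noteq> k \<and>
        ?z = X i * X j + X i * X k + X j * X k + X i + X j + C c) \<longleftrightarrow>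
      (\<exists>i\<in>?V. \<exists>j\<in>?V. \<exists>k\<in>?V. i \<noteq> j \<and> i \<noteq> k \<and> j \<noteq> k \<and>
        (\<forall>x. ?F x = maj (x i) (x j) (x k + 1) + c))" for c
    by (intro bex_cong conj_cong refl maj1)
  have ex_bit: "(\<exists>e::bit. P e) \<longleftrightarrow> P 0 \<or> P 1" for P
    by (metis bit.exhaust)
  have 5: "(\<exists>e. \<forall>x. ?F x = maj (x i) (x j) (x k + e) + c) \<longleftrightarrow>
      (\<forall>x. ?F x = maj (x i) (x j) (x k + 0) + c) \<or> (\<forall>x. ?F x = maj (x i) (x j) (x k + 1) + c)"
    for i j k c
    by (rule ex_bit)
  show ?thesis
    unfolding special_form_def special_fun_def 1 2 3 4 5
    by (simp only: conj_disj_distribL bex_disj_distrib disj_assoc)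
qed

theorem theorem6:
  fixes N :: nat and f :: "(nat \<Rightarrow> bit) \<Rightarrow> bit"
  assumes "0 < N"
    and "2 \<le> ess N f"
  shows "(gap N f = 2 \<longleftrightarrow> special_form N (zhegalkin N f)) \<and>
         (\<not> special_form N (zhegalkin N f) \<longrightarrow> gap N f = 1)"
  using gap_classification[OF assms] by (simp add: special_form_zhegalkin_iff)

end
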